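(* Let $k\ge1$ and $n\ge 2k$. The Mandelstam variety $\mathrm{M}(k,n,k)$ is the Hadamard square of the Grassmannian $\mathrm{Gr}(k,n)$. It contains all other Mandelstam varieties by the chain of inclusions $$\mathrm{M}(k,n,0)\subset\mathrm{M}(k,n,1)\subset\mathrm{M}(k,n,2)\subset\cdots\subset\mathrm{M}(k,n,k).$$ There is a natural chain of dominant deletion maps, induced by removing columns in $\lambda$ and $\tilde\lambda$: $$\mathrm{M}(k,n,0)\dashrightarrow\mathrm{M}(k,n-1,1)\dashrightarrow\mathrm{M}(k,n-2,2)\dashrightarrow\cdots\dashrightarrow\mathrm{M}(k,n-k,k).$$
   Context: $\mathrm{Gr}(k,n)\subset\mathbb{P}^{\binom nk-1}$ is the Grassmannian of $k$-dimensional subspaces of $\mathbb{C}^n$ in its Plücker embedding. $\mathrm{SH}(k,n,r)\subset\mathrm{Gr}(k,n)\times\mathrm{Gr}(k,n)$ is the set of pairs $(V,W)$ with $\dim(V\cap W^\perp)\ge k-r$, where $W^\perp$ is the orthogonal complement for the standard bilinear form; equivalently, writing $V,W$ as row spaces of rank-$k$ matrices $\lambda,\tilde\lambda\in\mathbb{C}^{k\times n}$, the condition is $\mathrm{rank}(\lambda\tilde\lambda^T)\le r$. With $\langle i_1\cdots i_k\rangle$, $[i_1\cdots i_k]$ the maximal minors of $\lambda$, $\tilde\lambda$, the Mandelstam variety $\mathrm{M}(k,n,r)\subset\mathbb{P}^{\binom nk-1}$ is the Zariski closure of the image of $\mathrm{SH}(k,n,r)$ under the rational map given by the componentwise products $s_{i_1\cdots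 i_k}=\langle i_1\cdots i_k\rangle[i_1\cdots i_k]$. The Hadamard square of a projective variety $X\subset\mathbb{P}^m$ is the Zariski closure of the set of all (defined) componentwise products $x\star y$ with $x,y\in X$. The deletion map $\mathrm{M}(k,n,r)\dashrightarrow\mathrm{M}(k,n-1,r+1)$ is induced by deleting the last column of $\lambda$ and of $\tilde\lambda$; in coordinates it forgets all $s_{i_1\cdots i_k}$ with an index equal to $n$. *)

theory Defs
  imports
    "Jordan_Normal_Form.DL_Rank"
    "Jordan_Normal_Form.DL_Submatrix"
    "HOL-Library.Poly_Mapping"
begin

section \<open>Complex projective space and its Zariski closure\<close>

text \<open>
  For a finite set \<open>J\<close> of coordinate indices, the projective space with homogeneous coordinates
  indexed by \<open>J\<close> consists of the punctured lines \<open>point x\<close>, where \<open>x\<close> is a nonzero coordinate vector.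
  Coordinate vectors are total functions that vanish outside \<open>J\<close>.
\<close>

definition coord_vecs :: "'i set \<Rightarrow> ('i \<Rightarrow> complex) set" where
  "coord_vecs J = {x. \<forall>i. i \<notin> J \<longrightarrow> x i = 0}"

definition point :: "('i \<Rightarrow> complex) \<Rightarrow> ('i \<Rightarrow> complex) set" where
  "point x = {(\<lambda>i. c * x i) | c. c \<noteq> 0}"

definition proj_space :: "'i set \<Rightarrow> ('i \<Rightarrow> complex) set set" where
  "proj_space J = {point x | x. x \<in> coord_vecs J \<and> x \<noteq> (\<lambda>_. 0)}"

text \<open>
  A polynomial is a finitely supported map from monomials to coefficients, a monomial a finitely
  supported map from variables to exponents.
\<close>

type_synonym 'i cpoly = "('i \<Rightarrow>\<^sub>0 nat) \<Rightarrow>\<^sub>0 complex"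

definition poly_value :: "'i cpoly \<Rightarrow> ('i \<Rightarrow> complex) \<Rightarrow> complex" where
  "poly_value f x =
     (\<Sum>m\<in>Poly_Mapping.keys f. Poly_Mapping.lookup f m * (\<Prod>i\<in>Poly_Mapping.keys m. x i ^ Poly_Mapping.lookup m i))"

definition forms :: "'i set \<Rightarrow> 'i cpoly set" where
  "forms J = {f. \<exists>d. \<forall>m\<in>Poly_Mapping.keys f. Poly_Mapping.keys m \<subseteq> J \<and> (\<Sum>i\<in>Poly_Mapping.keys m. Poly_Mapping.lookup m i) = d}"

definition vanishes_at :: "'i cpoly \<Rightarrow> ('i \<Rightarrow> complex) set \<Rightarrow> bool" where
  "vanishes_at f p \<longleftrightarrow> (\<forall>x\<in>p. poly_value f x = 0)"

definition zariski_closure :: "'i set \<Rightarrow> ('i \<Rightarrow> complex) set set \<Rightarrow> ('i \<Rightarrow> complex) set set" where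
  "zariski_closure J S =
     {p \<in> proj_space J. \<forall>f\<in>forms J. (\<forall>q\<in>S. vanishes_at f q) \<longrightarrow> vanishes_at f p}"

definition hadamard_square :: "'i set \<Rightarrow> ('i \<Rightarrow> complex) set set \<Rightarrow> ('i \<Rightarrow> complex) set set" where
  "hadamard_square J X = zariski_closure J
     {point (\<lambda>i. x i * y i) | x y p q.
        p \<in> X \<and> q \<in> X \<and> x \<in> p \<and> y \<in> q \<and> (\<lambda>i. x i * y i) \<noteq> (\<lambda>_. 0)}"

section \<open>Grassmannians and Mandelstam varieties\<close>

definition subspace_dim :: "nat \<Rightarrow> complex vec set \<Rightarrow> nat" where
  "subspace_dim n V = vectorspace.dim class_ring (module_vec TYPE(complex) n\<lparr>carrier := V\<rparr>)"

definition subspaces :: "nat \<Rightarrow> nat \<Rightarrow> complex vec set set" where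
  "subspaces k n =
     {V. VectorSpace.subspace class_ring V (module_vec TYPE(complex) n) \<and> subspace_dim n V = k}"

text \<open>
  Columns, and hence the indices of the Plucker coordinates, are numbered from \<open>0\<close> to \<open>n - 1\<close>.
\<close>

definition ksubsets :: "nat \<Rightarrow> nat \<Rightarrow> nat set set" where
  "ksubsets k n = {I. I \<subseteq> {0..<n} \<and> card I = k}"

definition maximal_minors :: "nat \<Rightarrow> nat \<Rightarrow> complex mat \<Rightarrow> nat set \<Rightarrow> complex" where
  "maximal_minors k n A = (\<lambda>I. if I \<in> ksubsets k n then det (submatrix A UNIV I) else 0)"

definition grassmannian :: "nat \<Rightarrow> nat \<Rightarrow> (nat set \<Rightarrow> complex) set set" where
  "grassmannian k n =
     {point (maximal_minors k n A) | A.
        A \<in> carrier_mat k n \<and> vec_space.row_space n A \<in> subspaces k n}"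

text \<open>
  \<open>orthogonal_complement\<close> is taken with respect to the bilinear dot product, without complex
  conjugation. The subtraction is truncated: for \<open>r \<ge> k\<close> there is no condition on the pair.
\<close>

definition SH :: "nat \<Rightarrow> nat \<Rightarrow> nat \<Rightarrow> (complex vec set \<times> complex vec set) set" where
  "SH k n r = {(V, W). V \<in> subspaces k n \<and> W \<in> subspaces k n \<and>
     subspace_dim n (V \<inter> vec_module.orthogonal_complement n W) \<ge> k - r}"

definition mandelstam_coords ::
    "nat \<Rightarrow> nat \<Rightarrow> complex mat \<Rightarrow> complex mat \<Rightarrow> nat set \<Rightarrow> complex" where
  "mandelstam_coords k n A B = (\<lambda>I. maximal_minors k n A I * maximal_minors k n B I)"

definition mandelstam :: "nat \<Rightarrow> nat \<Rightarrow> nat \<Rightarrow> (nat set \<Rightarrow> complex) set set" where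
  "mandelstam k n r = zariski_closure (ksubsets k n)
     {point (mandelstam_coords k n A B) | A B.
        A \<in> carrier_mat k n \<and> B \<in> carrier_mat k n \<and>
        (vec_space.row_space n A, vec_space.row_space n B) \<in> SH k n r \<and>
        mandelstam_coords k n A B \<noteq> (\<lambda>_. 0)}"

section \<open>Deletion maps\<close>

definition forget_last :: "nat \<Rightarrow> (nat set \<Rightarrow> complex) \<Rightarrow> (nat set \<Rightarrow> complex)" where
  "forget_last n x = (\<lambda>I. if n - 1 \<in> I then 0 else x I)"

definition deletion_domain ::
    "nat \<Rightarrow> (nat set \<Rightarrow> complex) set set \<Rightarrow> (nat set \<Rightarrow> complex) set set" where
  "deletion_domain n X = {p \<in> X. \<forall>x\<in>p. forget_last n x \<noteq> (\<lambda>_. 0)}"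

text \<open>On a point in its domain, \<open>forget_last n ` point x = point (forget_last n x)\<close>.\<close>

definition deletion :: "nat \<Rightarrow> (nat set \<Rightarrow> complex) set \<Rightarrow> (nat set \<Rightarrow> complex) set" where
  "deletion n p = forget_last n ` p"

text \<open>
  The domain of definition is required to be dense in \<open>X\<close>, so that this is a rational map also
  without knowing that \<open>X\<close> is irreducible.
\<close>

definition deletion_rational_map ::
    "nat \<Rightarrow> nat \<Rightarrow> (nat set \<Rightarrow> complex) set set \<Rightarrow> (nat set \<Rightarrow> complex) set set \<Rightarrow> bool" where
  "deletion_rational_map k n X Y \<longleftrightarrow>
     zariski_closure (ksubsets k n) (deletion_domain n X) = X \<and>
     deletion n ` deletion_domain n X \<subseteq> Y"

definition deletion_dominant ::
    "nat \<Rightarrow> nat \<Rightarrow> (nat set \<Rightarrow> complex) set set \<Rightarrow> (nat set \<Rightarrow> complex) set set \<Rightarrow> bool" where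
  "deletion_dominant k n X Y \<longleftrightarrow>
     zariski_closure (ksubsets k (n - 1)) (deletion n ` deletion_domain n X) = Y"

definition delete_last_col :: "complex mat \<Rightarrow> complex mat" where
  "delete_last_col A = mat (dim_row A) (dim_col A - 1) (\<lambda>(i, j). A $$ (i, j))"

text \<open>
  The coordinate projection is the map induced on Mandelstam coordinates by deleting the last
  column of both matrices; on pairs of subspaces that deletion is defined when both truncated
  matrices still have row space of dimension \<open>k\<close>.
\<close>

definition deletion_induced_by_columns :: "nat \<Rightarrow> nat \<Rightarrow> nat \<Rightarrow> bool" where
  "deletion_induced_by_columns k n r \<longleftrightarrow>
     (\<forall>A B. A \<in> carrier_mat k n \<and> B \<in> carrier_mat k n \<and>
        (vec_space.row_space n A, vec_space.row_space n B) \<in> SH k n r \<longrightarrow>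
        forget_last n (mandelstam_coords k n A B) =
          mandelstam_coords k (n - 1) (delete_last_col A) (delete_last_col B) \<and>
        (vec_space.row_space (n - 1) (delete_last_col A) \<in> subspaces k (n - 1) \<and>
         vec_space.row_space (n - 1) (delete_last_col B) \<in> subspaces k (n - 1) \<longrightarrow>
         (vec_space.row_space (n - 1) (delete_last_col A),
          vec_space.row_space (n - 1) (delete_last_col B)) \<in> SH k (n - 1) (r + 1)))"

end

theory Submission
  imports Defs "Jordan_Normal_Form.Column_Operations"
begin

text \<open>
  All pairs \<open>(V, W)\<close> satisfy the incidence condition for \<open>r = k\<close>, so the parametrised points of
  \<open>M(k,n,k)\<close> are exactly the coordinatewise products of points of the Grassmannian; and the condition
  weakens as \<open>r\<close> grows, which gives the inclusions.

  For the deletion maps, let \<open>U = V \<inter> W\<^sup>\<bottom>\<close>. Deleting the last column of both matrices keeps the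
  vectors of \<open>U\<close> with last coordinate zero, and these form a subspace of codimension at most one in \<open>U\<close>
  (\<open>SH_delete_last_col\<close>). Conversely, for \<open>r < k\<close> a suitable new column on each side
  raises an intersection of dimension \<open>k - r - 1\<close> to dimension \<open>k - r\<close> (\<open>SH_lift\<close>). Hence every
  parametrised point of \<open>M(k,n-1,r+1)\<close> is the deletion of a parametrised point of \<open>M(k,n,r)\<close>, and the map is dominant.

  It remains to see that the deletion map is defined on a dense subset. Instead of proving
  irreducibility of \<open>M(k,n,r)\<close>, one moves an arbitrary pair of matrices along explicit curves. A shear
  of the columns of \<open>A\<close> together with the inverse transposed shear of \<open>B\<close> preserves the bilinear form
  between the row spaces and therefore the incidence condition (\<open>SH_shear\<close>). Since \<open>n > k\<close>, a nonzero minor that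
  uses the last column can be exchanged for one that avoids it (\<open>maximal_minor_exchange\<close>), and two such shears, one for each
  matrix, make the same minor nonzero on both sides for arbitrarily small parameters. A form that vanishes
  at all points surviving deletion then vanishes, by continuity, at every parametrised point
  (\<open>poly_value_zero_by_perturbation\<close>).
\<close>

section \<open>Dimensions of subspaces of coordinate space\<close>

abbreviation lin_subspace :: "nat \<Rightarrow> complex vec set \<Rightarrow> bool" where
  "lin_subspace n S \<equiv> VectorSpace.subspace class_ring S (module_vec TYPE(complex) n)"

lemma lin_subspaceI:
  assumes "S \<subseteq> carrier_vec n" "0\<^sub>v n \<in> S"
    and "\<And>x y. x \<in> S \<Longrightarrow> y \<in> S \<Longrightarrow> x + y \<in> S"
    and "\<And>c x. x \<in> S \<Longrightarrow> c \<cdot>\<^sub>v x \<in> S"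
  shows "lin_subspace n S"
  using assms vec_vs[of n, where 'a = complex] vec_module[of n, where 'a = complex]
  unfolding VectorSpace.subspace_def submodule_def
  by (auto simp: module_vec_simps)

lemma lin_subspaceD:
  assumes "lin_subspace n S"
  shows "S \<subseteq> carrier_vec n" "0\<^sub>v n \<in> S"
    and "\<And>x y. x \<in> S \<Longrightarrow> y \<in> S \<Longrightarrow> x + y \<in> S"
    and "\<And>c x. x \<in> S \<Longrightarrow> c \<cdot>\<^sub>v x \<in> S"
  using assms unfolding VectorSpace.subspace_def submodule_def
  by (auto simp: module_vec_simps class_ring_simps)

lemma lin_subspace_vectorspace:
  assumes "lin_subspace n S"
  shows "vectorspace class_ring (module_vec TYPE(complex) n\<lparr>carrier := S\<rparr>)"
  using vectorspace.subspace_is_vs[OF vec_vs assms] .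

text \<open>
  Linearly independent subsets of \<open>S\<close> have at most \<open>n\<close> elements, so a maximal one exists; it
  generates \<open>S\<close>.
\<close>

lemma lin_subspace_fin_dim:
  assumes S: "lin_subspace n S"
  shows "vectorspace.fin_dim class_ring (module_vec TYPE(complex) n\<lparr>carrier := S\<rparr>)"
proof -
  interpret V: vec_space "TYPE(complex)" n .
  interpret W: vectorspace class_ring "module_vec TYPE(complex) n\<lparr>carrier := S\<rparr>"
    by (rule lin_subspace_vectorspace[OF S])
  have sub: "submodule class_ring S (module_vec TYPE(complex) n)"
    using S by (simp add: VectorSpace.subspace_def)
  have SV: "S \<subseteq> carrier_vec n" by (rule lin_subspaceD(1)[OF S])
  have bound: "finite T \<and> card T \<le> n" if "T \<subseteq> S \<and> W.lin_indpt T" for T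
  proof -
    have "V.lin_indpt T"
      using V.span_li_not_depend(2)[OF _ sub, of T] that by simp
    then show ?thesis
      using V.li_le_dim[OF V.fin_dim, of T] that SV by (auto simp: V.dim_is_n)
  qed
  have "W.lin_indpt {}" by (simp add: W.lin_dep_def)
  then have "\<exists>T. finite T \<and> maximal T (\<lambda>T. T \<subseteq> S \<and> W.lin_indpt T)"
    using maximal_exists[of "\<lambda>T. T \<subseteq> S \<and> W.lin_indpt T" n "{}", OF bound] by blast
  then obtain T where T: "finite T" "maximal T (\<lambda>T. T \<subseteq> S \<and> W.lin_indpt T)" by blast
  then have "W.basis T" using W.max_li_is_basis[of T] by simp
  then show ?thesis using T(1) unfolding W.fin_dim_def W.basis_def by blast
qed

lemma subspace_dim_carrier [simp]: "subspace_dim n (carrier_vec n) = n"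
proof -
  interpret V: vec_space "TYPE(complex)" n .
  have "module_vec TYPE(complex) n\<lparr>carrier := carrier_vec n\<rparr> = module_vec TYPE(complex) n"
    by (simp add: module_vec_def)
  then show ?thesis unfolding subspace_dim_def using V.dim_is_n by (simp only:)
qed

lemma subspace_dim_mono:
  assumes S: "lin_subspace n S" and T: "lin_subspace n T" and "S \<subseteq> T"
  shows "subspace_dim n S \<le> subspace_dim n T"
proof -
  interpret V: vec_space "TYPE(complex)" n .
  interpret W: vectorspace class_ring "module_vec TYPE(complex) n\<lparr>carrier := T\<rparr>"
    by (rule lin_subspace_vectorspace[OF T])
  have "VectorSpace.subspace class_ring S (module_vec TYPE(complex) n\<lparr>carrier := T\<rparr>)"
    using V.nested_subspaces[OF T S] assms(3) by simp
  from W.subspace_dim[OF this lin_subspace_fin_dim[OF T]] lin_subspace_fin_dim[OF S]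
  show ?thesis by (simp add: subspace_dim_def)
qed

lemma linear_map_on_subspace:
  assumes S: "lin_subspace n S"
    and "\<And>x. x \<in> S \<Longrightarrow> T x \<in> carrier_vec m"
    and "\<And>x y. x \<in> S \<Longrightarrow> y \<in> S \<Longrightarrow> T (x + y) = T x + T y"
    and "\<And>c x. x \<in> S \<Longrightarrow> T (c \<cdot>\<^sub>v x) = c \<cdot>\<^sub>v T x"
  shows "linear_map class_ring (module_vec TYPE(complex) n\<lparr>carrier := S\<rparr>) (module_vec TYPE(complex) m) T"
proof -
  interpret V: vectorspace class_ring "module_vec TYPE(complex) n\<lparr>carrier := S\<rparr>"
    by (rule lin_subspace_vectorspace[OF S])
  interpret W: vec_space "TYPE(complex)" m .
  show ?thesis
    by (unfold_locales, unfold LinearCombinations.module_hom_def, intro CollectI conjI allI impI)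
      (use assms(2-) in \<open>simp_all add: module_vec_simps\<close>)
qed

text \<open>
  Every comparison of dimensions below comes from this one formula, applied either to an injective
  map or to a linear functional.
\<close>

lemma rank_nullity_on_subspace:
  assumes S: "lin_subspace n S"
    and T: "\<And>x. x \<in> S \<Longrightarrow> T x \<in> carrier_vec m"
      "\<And>x y. x \<in> S \<Longrightarrow> y \<in> S \<Longrightarrow> T (x + y) = T x + T y"
      "\<And>c x. x \<in> S \<Longrightarrow> T (c \<cdot>\<^sub>v x) = c \<cdot>\<^sub>v T x"
  shows "lin_subspace m (T ` S)" "lin_subspace n {x \<in> S. T x = 0\<^sub>v m}"
    and "subspace_dim n S = subspace_dim m (T ` S) + subspace_dim n {x \<in> S. T x = 0\<^sub>v m}"
proof -
  interpret L: linear_map class_ring "module_vec TYPE(complex) n\<lparr>carrier := S\<rparr>"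
      "module_vec TYPE(complex) m" T
    by (rule linear_map_on_subspace[OF S T])
  have im: "L.im = T ` S" by (simp add: L.im_def)
  have ker: "L.ker = {x \<in> S. T x = 0\<^sub>v m}" by (simp add: L.ker_def module_vec_simps)
  show "lin_subspace m (T ` S)" using L.imT_is_subspace by (simp add: im)
  show "lin_subspace n {x \<in> S. T x = 0\<^sub>v m}"
  proof -
    interpret W: vec_space "TYPE(complex)" m .
    show ?thesis
    proof (rule lin_subspaceI)
      have "T (0 \<cdot>\<^sub>v 0\<^sub>v n) = 0 \<cdot>\<^sub>v T (0\<^sub>v n)" using T(3) lin_subspaceD(2)[OF S] by blast
      also have "\<dots> = 0\<^sub>v m" using T(1)[OF lin_subspaceD(2)[OF S]] by auto
      also have "0 \<cdot>\<^sub>v 0\<^sub>v n = (0\<^sub>v n :: complex vec)" by auto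
      finally show "0\<^sub>v n \<in> {x \<in> S. T x = 0\<^sub>v m}" using lin_subspaceD(2)[OF S] by simp
    qed (use lin_subspaceD[OF S] T in auto)
  qed
  show "subspace_dim n S = subspace_dim m (T ` S) + subspace_dim n {x \<in> S. T x = 0\<^sub>v m}"
    using L.rank_nullity[OF lin_subspace_fin_dim[OF S]]
    unfolding im ker subspace_dim_def by simp
qed

lemma subspace_dim_le_if_inj_into:
  assumes S: "lin_subspace n S" and S': "lin_subspace m S'"
    and T: "\<And>x. x \<in> S \<Longrightarrow> T x \<in> S'"
      "\<And>x y. x \<in> S \<Longrightarrow> y \<in> S \<Longrightarrow> T (x + y) = T x + T y"
      "\<And>c x. x \<in> S \<Longrightarrow> T (c \<cdot>\<^sub>v x) = c \<cdot>\<^sub>v T x"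
    and inj: "\<And>x. x \<in> S \<Longrightarrow> T x = 0\<^sub>v m \<Longrightarrow> x = 0\<^sub>v n"
  shows "subspace_dim n S \<le> subspace_dim m S'"
proof -
  have Tc: "\<And>x. x \<in> S \<Longrightarrow> T x \<in> carrier_vec m" using T(1) lin_subspaceD(1)[OF S'] by blast
  note rn = rank_nullity_on_subspace[OF S Tc T(2,3)]
  have "{x \<in> S. T x = 0\<^sub>v m} = {0\<^sub>v n}"
    using inj lin_subspaceD(2)[OF rn(2)] by blast
  moreover have "subspace_dim n {0\<^sub>v n} = 0"
  proof -
    have sub: "lin_subspace n {0\<^sub>v n}" by (rule lin_subspaceI) auto
    \<comment> \<open>For the identity on the zero space the formula reads \<open>d = d + d\<close>.\<close>
    show ?thesis using rank_nullity_on_subspace(3)[OF sub, of "\<lambda>x. x" n] by simp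
  qed
  ultimately have "subspace_dim n {x \<in> S. T x = 0\<^sub>v m} = 0" by simp
  then have "subspace_dim n S = subspace_dim m (T ` S)" using rn(3) by simp
  also have "\<dots> \<le> subspace_dim m S'"
    by (rule subspace_dim_mono[OF rn(1) S']) (use T(1) in auto)
  finally show ?thesis .
qed

text \<open>
  A linear functional has image of dimension at most one, and exactly one if it is not identically
  zero on \<open>S\<close>.
\<close>

lemma subspace_dim_functional:
  assumes S: "lin_subspace n S" and b: "b \<in> carrier_vec n"
  shows "lin_subspace n {x \<in> S. b \<bullet> x = 0}"
    and "subspace_dim n S \<le> subspace_dim n {x \<in> S. b \<bullet> x = 0} + 1"
    and "x0 \<in> S \<Longrightarrow> b \<bullet> x0 \<noteq> 0 \<Longrightarrow> subspace_dim n S \<ge> subspace_dim n {x \<in> S. b \<bullet> x = 0} + 1"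
proof -
  define T where "T = (\<lambda>x. vec 1 (\<lambda>_. b \<bullet> x))"
  have SV: "S \<subseteq> carrier_vec n" by (rule lin_subspaceD(1)[OF S])
  have T: "\<And>x. x \<in> S \<Longrightarrow> T x \<in> carrier_vec 1" 
      "\<And>x y. x \<in> S \<Longrightarrow> y \<in> S \<Longrightarrow> T (x + y) = T x + T y"
      "\<And>c x. x \<in> S \<Longrightarrow> T (c \<cdot>\<^sub>v x) = c \<cdot>\<^sub>v T x"
    using SV b by (auto simp: T_def scalar_prod_add_distrib[of b n] subset_iff)
  note rn = rank_nullity_on_subspace[OF S T]
  have T0: "T x = 0\<^sub>v 1 \<longleftrightarrow> b \<bullet> x = 0" for x by (auto simp: T_def vec_eq_iff)
  show "lin_subspace n {x \<in> S. b \<bullet> x = 0}" using rn(2) by (simp only: T0)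
  have c: "lin_subspace 1 (carrier_vec 1)" by (rule lin_subspaceI) auto
  have "subspace_dim 1 (T ` S) \<le> 1"
    using subspace_dim_mono[OF rn(1) c lin_subspaceD(1)[OF rn(1)]] subspace_dim_carrier[of 1] by simp
  then show "subspace_dim n S \<le> subspace_dim n {x \<in> S. b \<bullet> x = 0} + 1"
    using rn(3) by (simp only: T0)
  assume x0: "x0 \<in> S" "b \<bullet> x0 \<noteq> 0"
  have "carrier_vec 1 \<subseteq> T ` S"
  proof
    fix v :: "complex vec" assume v: "v \<in> carrier_vec 1"
    have "T ((v $ 0 / (b \<bullet> x0)) \<cdot>\<^sub>v x0) = v"
      using x0 v b SV by (auto simp: T_def vec_eq_iff subset_iff)
    then show "v \<in> T ` S" using lin_subspaceD(4)[OF S x0(1)] by (metis imageI)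
  qed
  from subspace_dim_mono[OF c rn(1) this] 
  have "1 \<le> subspace_dim 1 (T ` S)" using subspace_dim_carrier[of 1] by simp
  then show "subspace_dim n S \<ge> subspace_dim n {x \<in> S. b \<bullet> x = 0} + 1"
    using rn(3) by (simp only: T0)
qed

section \<open>Row spaces and the incidence condition\<close>

lemma row_space_image:
  fixes A :: "complex mat"
  assumes "A \<in> carrier_mat k n"
  shows "vec_space.row_space n A = (\<lambda>y. A\<^sup>T *\<^sub>v y) ` carrier_vec k"
proof -
  interpret vec_space "TYPE(complex)" n .
  have "A\<^sup>T *\<^sub>v y \<in> carrier_vec n" if "y \<in> carrier_vec k" for y
    using assms that by auto
  then show ?thesis using row_space_eq[OF assms] assms by auto
qed

lemma row_space_rank_nullity:
  assumes "A \<in> carrier_mat k n"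
  shows "lin_subspace n (vec_space.row_space n A)"
    and "k = subspace_dim n (vec_space.row_space n A)
               + subspace_dim k {y \<in> carrier_vec k. A\<^sup>T *\<^sub>v y = 0\<^sub>v n}"
proof -
  have c: "lin_subspace k (carrier_vec k)" by (rule lin_subspaceI) auto
  have T: "\<And>x. x \<in> carrier_vec k \<Longrightarrow> A\<^sup>T *\<^sub>v x \<in> carrier_vec n"
    "\<And>x y. x \<in> carrier_vec k \<Longrightarrow> y \<in> carrier_vec k \<Longrightarrow> A\<^sup>T *\<^sub>v (x + y) = A\<^sup>T *\<^sub>v x + A\<^sup>T *\<^sub>v y"
    "\<And>a x. x \<in> carrier_vec k \<Longrightarrow> A\<^sup>T *\<^sub>v (a \<cdot>\<^sub>v x) = a \<cdot>\<^sub>v (A\<^sup>T *\<^sub>v x)"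
    using assms by (auto simp: mult_add_distrib_mat_vec[of _ n k] mult_mat_vec[of _ n k])
  note rn = rank_nullity_on_subspace[OF c T]
  show "lin_subspace n (vec_space.row_space n A)"
    using rn(1) row_space_image[OF assms] by simp
  show "k = subspace_dim n (vec_space.row_space n A)
               + subspace_dim k {y \<in> carrier_vec k. A\<^sup>T *\<^sub>v y = 0\<^sub>v n}"
    using rn(3) row_space_image[OF assms] by simp
qed

lemma row_space_in_subspacesI:
  assumes A: "A \<in> carrier_mat k n"
    and inj: "\<And>y. y \<in> carrier_vec k \<Longrightarrow> A\<^sup>T *\<^sub>v y = 0\<^sub>v n \<Longrightarrow> y = 0\<^sub>v k"
  shows "vec_space.row_space n A \<in> subspaces k n"
proof -
  have c: "lin_subspace k (carrier_vec k)" by (rule lin_subspaceI) auto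
  have "subspace_dim k (carrier_vec k) \<le> subspace_dim n (vec_space.row_space n A)"
    by (rule subspace_dim_le_if_inj_into[OF c row_space_rank_nullity(1)[OF A], of "\<lambda>y. A\<^sup>T *\<^sub>v y"])
      (use A inj in \<open>auto simp: row_space_image[OF A] mult_add_distrib_mat_vec[of _ n k] mult_mat_vec[of _ n k]\<close>)
  moreover have "subspace_dim n (vec_space.row_space n A) \<le> k"
    using row_space_rank_nullity(2)[OF A] by linarith
  ultimately show ?thesis
    using row_space_rank_nullity(1)[OF A] by (simp add: subspaces_def)
qed

text \<open>
  Column operations act on row spaces by a linear map. This reduces shearing, deleting and
  appending columns to a linear map between two coordinate spaces.
\<close>

lemma row_space_mult:
  fixes A G :: "complex mat"
  assumes A: "A \<in> carrier_mat k n" and G: "G \<in> carrier_mat n m"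
  shows "vec_space.row_space m (A * G) = (\<lambda>x. G\<^sup>T *\<^sub>v x) ` vec_space.row_space n A"
proof -
  have "(A * G)\<^sup>T *\<^sub>v y = G\<^sup>T *\<^sub>v (A\<^sup>T *\<^sub>v y)" if "y \<in> carrier_vec k" for y
    using A G that by (simp add: transpose_mult[OF A G] assoc_mult_mat_vec[of _ m n _ k])
  then show ?thesis
    using A G by (simp add: row_space_image[OF A] row_space_image[of "A * G" k m] image_image)
qed

lemma row_space_mult_in_subspaces:
  assumes A: "A \<in> carrier_mat k n" and G: "G \<in> carrier_mat n m"
    and V: "vec_space.row_space n A \<in> subspaces k n"
    and inj: "\<And>x. x \<in> carrier_vec n \<Longrightarrow> G\<^sup>T *\<^sub>v x = 0\<^sub>v m \<Longrightarrow> x = 0\<^sub>v n"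
  shows "vec_space.row_space m (A * G) \<in> subspaces k m"
proof -
  have AG: "A * G \<in> carrier_mat k m" using A G by simp
  have V': "lin_subspace n (vec_space.row_space n A)" "subspace_dim n (vec_space.row_space n A) = k"
    using V by (auto simp: subspaces_def)
  have "k \<le> subspace_dim m (vec_space.row_space m (A * G))"
    unfolding V'(2)[symmetric]
    by (rule subspace_dim_le_if_inj_into[OF V'(1) row_space_rank_nullity(1)[OF AG], of "\<lambda>y. G\<^sup>T *\<^sub>v y"])
      (use G inj lin_subspaceD(1)[OF V'(1)] in \<open>auto simp: row_space_mult[OF A G] subset_iff
        mult_add_distrib_mat_vec[of _ m n] mult_mat_vec[of _ m n]\<close>)
  moreover have "subspace_dim m (vec_space.row_space m (A * G)) \<le> k"
    using row_space_rank_nullity(2)[OF AG] by linarith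
  ultimately show ?thesis
    using row_space_rank_nullity(1)[OF AG] by (simp add: subspaces_def)
qed

lemma orthogonal_complement_iff:
  "x \<in> vec_module.orthogonal_complement n W \<longleftrightarrow> x \<in> carrier_vec n \<and> (\<forall>y\<in>W. x \<bullet> y = 0)"
proof -
  interpret vec_space "TYPE(complex)" n .
  show ?thesis by (auto simp: vec_module.orthogonal_complement_def)
qed

lemma lin_subspace_inter_orthogonal_complement:
  assumes V: "lin_subspace n V" and W: "W \<subseteq> carrier_vec n"
  shows "lin_subspace n (V \<inter> vec_module.orthogonal_complement n W)"
  by (rule lin_subspaceI)
    (use lin_subspaceD[OF V] W in \<open>auto simp: orthogonal_complement_iff subset_iff
      add_scalar_prod_distrib[of _ n]\<close>)

lemma transpose_mult_scalar_prod:
  fixes G H :: "complex mat"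
  assumes "G \<in> carrier_mat n m" "H \<in> carrier_mat p m" "x \<in> carrier_vec n" "y \<in> carrier_vec p"
  shows "(G\<^sup>T *\<^sub>v x) \<bullet> (H\<^sup>T *\<^sub>v y) = x \<bullet> ((G * H\<^sup>T) *\<^sub>v y)"
  using assms transpose_vec_mult_scalar[of G n m "H\<^sup>T *\<^sub>v y" x]
  by (simp add: assoc_mult_mat_vec[of _ n m _ p])

text \<open>
  The pair of maps \<open>G\<^sup>T\<close>, \<open>H\<^sup>T\<close> preserves the bilinear form when \<open>G H\<^sup>T = 1\<close>, so \<open>G\<^sup>T\<close> carries
  \<open>V \<inter> W\<^sup>\<bottom>\<close> into the corresponding intersection for the transformed pair.
\<close>

lemma SH_mult:
  assumes A: "A \<in> carrier_mat k n" and B: "B \<in> carrier_mat k n"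
    and G: "G \<in> carrier_mat n n" and H: "H \<in> carrier_mat n n" and GH: "G * H\<^sup>T = 1\<^sub>m n"
    and SH: "(vec_space.row_space n A, vec_space.row_space n B) \<in> SH k n r"
  shows "(vec_space.row_space n (A * G), vec_space.row_space n (B * H)) \<in> SH k n r"
proof -
  let ?V = "vec_space.row_space n A" and ?W = "vec_space.row_space n B"
  let ?V' = "vec_space.row_space n (A * G)" and ?W' = "vec_space.row_space n (B * H)"
  have HG: "H * G\<^sup>T = 1\<^sub>m n"
    using arg_cong[OF GH, of transpose_mat] G H by (simp add: transpose_mult[of _ n n _ n])
  have inj1: "x = 0\<^sub>v n" if "x \<in> carrier_vec n" "G\<^sup>T *\<^sub>v x = 0\<^sub>v n" for x
  proof -
    have "(H * G\<^sup>T) *\<^sub>v x = H *\<^sub>v (G\<^sup>T *\<^sub>v x)"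
      using G H that(1) by (simp add: assoc_mult_mat_vec[of _ n n _ n])
    then show ?thesis using that G H by (simp add: HG vec_eq_iff scalar_prod_def)
  qed
  have inj2: "x = 0\<^sub>v n" if "x \<in> carrier_vec n" "H\<^sup>T *\<^sub>v x = 0\<^sub>v n" for x
  proof -
    have "(G * H\<^sup>T) *\<^sub>v x = G *\<^sub>v (H\<^sup>T *\<^sub>v x)"
      using G H that(1) by (simp add: assoc_mult_mat_vec[of _ n n _ n])
    then show ?thesis using that G H by (simp add: GH vec_eq_iff scalar_prod_def)
  qed
  from SH have VW: "?V \<in> subspaces k n" "?W \<in> subspaces k n"
    and d: "k - r \<le> subspace_dim n (?V \<inter> vec_module.orthogonal_complement n ?W)"
    by (auto simp: SH_def)
  have VW': "?V' \<in> subspaces k n" "?W' \<in> subspaces k n"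
    using row_space_mult_in_subspaces[OF A G VW(1) inj1] row_space_mult_in_subspaces[OF B H VW(2) inj2]
    by auto
  have sub: "lin_subspace n ?V" "lin_subspace n ?W" "lin_subspace n ?V'" "lin_subspace n ?W'"
    using VW VW' by (auto simp: subspaces_def)
  note carr = sub[THEN lin_subspaceD(1)]
  have "subspace_dim n (?V \<inter> vec_module.orthogonal_complement n ?W)
      \<le> subspace_dim n (?V' \<inter> vec_module.orthogonal_complement n ?W')"
  proof (rule subspace_dim_le_if_inj_into[of _ _ _ _ "\<lambda>x. G\<^sup>T *\<^sub>v x"])
    fix x assume "x \<in> ?V \<inter> vec_module.orthogonal_complement n ?W"
    then have x: "x \<in> ?V" "x \<in> carrier_vec n" "\<And>y. y \<in> ?W \<Longrightarrow> x \<bullet> y = 0"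
      by (auto simp: orthogonal_complement_iff)
    have "(G\<^sup>T *\<^sub>v x) \<bullet> (H\<^sup>T *\<^sub>v y) = 0" if "y \<in> ?W" for y
    proof -
      have "y \<in> carrier_vec n" using that carr(2) by blast
      then show ?thesis
        using transpose_mult_scalar_prod[OF G H x(2), of y] that x(3) by (simp add: GH)
    qed
    then show "G\<^sup>T *\<^sub>v x \<in> ?V' \<inter> vec_module.orthogonal_complement n ?W'"
      using x G by (auto simp: orthogonal_complement_iff row_space_mult[OF A G] row_space_mult[OF B H])
  qed (use sub carr inj1 G in \<open>auto simp: lin_subspace_inter_orthogonal_complement subset_iff
        mult_add_distrib_mat_vec[of _ n n] mult_mat_vec[of _ n n]\<close>)
  with d VW' show ?thesis by (simp add: SH_def)
qed

text \<open>
  Adding \<open>t\<close> times column \<open>l\<close> to column \<open>j\<close> on one side is balanced by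
  subtracting \<open>t\<close> times column \<open>j\<close> from column \<open>l\<close> on the other side. These families are polynomial in \<open>t\<close> and pass through the given pair at \<open>t = 0\<close>.
\<close>

lemma SH_shear:
  assumes A: "A \<in> carrier_mat k n" and B: "B \<in> carrier_mat k n"
    and jl: "j < n" "l < n" "j \<noteq> l"
    and SH: "(vec_space.row_space n A, vec_space.row_space n B) \<in> SH k n r"
  shows "(vec_space.row_space n (addcol t j l A), vec_space.row_space n (addcol (- t) l j B)) \<in> SH k n r"
proof -
  have "(addrow_mat n (- t) j l)\<^sup>T = addrow_mat n (- t) l j"
    using jl by (intro eq_matI) auto
  then have "addrow_mat n t l j * (addrow_mat n (- t) j l)\<^sup>T = 1\<^sub>m n"
    using addrow_mat_inv[of l n j t] jl by simp
  then show ?thesis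
    using SH_mult[OF A B _ _ _ SH, of "addrow_mat n t l j" "addrow_mat n (- t) j l"]
    by (simp add: addcol_mat[OF A jl(2)] addcol_mat[OF B jl(1)])
qed

section \<open>Deleting and appending a column\<close>

definition truncation :: "nat \<Rightarrow> complex mat" where
  "truncation p = mat p (Suc p) (\<lambda>(i, j). if i = j then 1 else 0)"

lemma truncation_carrier [simp]: "truncation p \<in> carrier_mat p (Suc p)"
  by (simp add: truncation_def)

lemma truncation_mult_vec:
  assumes "x \<in> carrier_vec (Suc p)"
  shows "truncation p *\<^sub>v x = vec p (\<lambda>i. x $ i)"
  using assms by (auto simp: truncation_def scalar_prod_def vec_eq_iff if_distrib[of "\<lambda>a. a * _"] cong: if_cong)

lemma delete_last_col_eq_mult:
  assumes "A \<in> carrier_mat k (Suc p)"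
  shows "delete_last_col A = A * (truncation p)\<^sup>T"
  using assms by (intro eq_matI) (auto simp: delete_last_col_def truncation_def scalar_prod_def if_distrib[of "\<lambda>a. _ * a"] cong: if_cong)

lemma scalar_prod_Suc:
  fixes x y :: "complex vec"
  assumes "x \<in> carrier_vec (Suc p)" "y \<in> carrier_vec (Suc p)"
  shows "x \<bullet> y = vec p (\<lambda>i. x $ i) \<bullet> vec p (\<lambda>i. y $ i) + x $ p * y $ p"
  using assms by (simp add: scalar_prod_def)

text \<open>
  Forgetting the last entry embeds the hyperplane section \<open>x\<^sub>p = 0\<close> of \<open>V \<inter> W\<^sup>\<bottom>\<close>: a vector with
  last entry zero is determined by its truncation and keeps its products with \<open>W\<close>. Passing to the
  hyperplane section costs at most one dimension, which is why \<open>r\<close> grows by one.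
\<close>

lemma SH_delete_last_col:
  assumes A: "A \<in> carrier_mat k (Suc p)" and B: "B \<in> carrier_mat k (Suc p)"
    and SH: "(vec_space.row_space (Suc p) A, vec_space.row_space (Suc p) B) \<in> SH k (Suc p) r"
    and VA: "vec_space.row_space p (delete_last_col A) \<in> subspaces k p"
    and VB: "vec_space.row_space p (delete_last_col B) \<in> subspaces k p"
  shows "(vec_space.row_space p (delete_last_col A), vec_space.row_space p (delete_last_col B)) \<in> SH k p (r + 1)"
proof -
  let ?V = "vec_space.row_space (Suc p) A" and ?W = "vec_space.row_space (Suc p) B"
  let ?V' = "vec_space.row_space p (delete_last_col A)" and ?W' = "vec_space.row_space p (delete_last_col B)"
  let ?T = "\<lambda>x :: complex vec. vec p (\<lambda>i. x $ i)"
  let ?U = "?V \<inter> vec_module.orthogonal_complement (Suc p) ?W"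
  let ?U' = "?V' \<inter> vec_module.orthogonal_complement p ?W'"
  from SH have VW: "lin_subspace (Suc p) ?V" "lin_subspace (Suc p) ?W"
    and d: "k - r \<le> subspace_dim (Suc p) ?U"
    by (auto simp: SH_def subspaces_def)
  from VA VB have sub': "lin_subspace p ?V'" "lin_subspace p ?W'" by (auto simp: subspaces_def)
  note carr = VW[THEN lin_subspaceD(1)] and carr' = sub'[THEN lin_subspaceD(1)]
  have U: "lin_subspace (Suc p) ?U" and U': "lin_subspace p ?U'"
    using VW sub' carr carr' by (auto simp: lin_subspace_inter_orthogonal_complement)
  have tr: "?V' = ?T ` ?V" "?W' = ?T ` ?W"
    using carr
    by (auto simp: delete_last_col_eq_mult[OF A] delete_last_col_eq_mult[OF B] subset_iff
        row_space_mult[OF A, of _ p] row_space_mult[OF B, of _ p] truncation_mult_vec intro!: image_cong)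
  let ?K = "{x \<in> ?U. unit_vec (Suc p) p \<bullet> x = 0}"
  have last: "unit_vec (Suc p) p \<bullet> x = x $ p" if "x \<in> carrier_vec (Suc p)" for x :: "complex vec"
    using that by simp
  have Kp: "x $ p = 0" if "x \<in> ?K" for x
    using that last[of x] by (auto simp: orthogonal_complement_iff)
  note f = subspace_dim_functional(1,2)[OF U unit_vec_carrier[of "Suc p" p]]
  have "subspace_dim (Suc p) ?K \<le> subspace_dim p ?U'"
  proof (rule subspace_dim_le_if_inj_into[OF f(1) U', of ?T])
    fix x assume x: "x \<in> ?K"
    have xc: "x \<in> carrier_vec (Suc p)" using x by (auto simp: orthogonal_complement_iff)
    have "?T x \<bullet> ?T y = 0" if "y \<in> ?W" for y
      using scalar_prod_Suc[OF xc, of y] that x carr(2) Kp[OF x] by (auto simp: orthogonal_complement_iff)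
    then show "?T x \<in> ?U'" using x by (auto simp: tr orthogonal_complement_iff)
  next
    fix x assume x: "x \<in> ?K" and T0: "?T x = 0\<^sub>v p"
    have xc: "x \<in> carrier_vec (Suc p)" using x by (auto simp: orthogonal_complement_iff)
    have "x $ i = 0" if "i < Suc p" for i
      using that Kp[OF x] T0 by (cases "i = p") (auto simp: vec_eq_iff)
    then show "x = 0\<^sub>v (Suc p)" using xc by (auto simp: vec_eq_iff)
  qed (use carr in \<open>auto simp: subset_iff vec_eq_iff orthogonal_complement_iff\<close>)
  then have "k - (r + 1) \<le> subspace_dim p ?U'" using f(2) d by linarith
  then show ?thesis using VA VB by (simp add: SH_def)
qed

text \<open>
  The matrix of \<open>x \<mapsto> (x, b \<bullet> x)\<close>: appending a column to a matrix so that its row space becomes the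
  graph of a linear functional.
\<close>

definition graph_mat :: "nat \<Rightarrow> complex vec \<Rightarrow> complex mat" where
  "graph_mat p b = mat (Suc p) p (\<lambda>(i, j). if i = p then b $ j else if i = j then 1 else 0)"

lemma graph_mat_carrier [simp]: "graph_mat p b \<in> carrier_mat (Suc p) p"
  by (simp add: graph_mat_def)

lemma graph_mat_mult_vec:
  assumes "x \<in> carrier_vec p" "b \<in> carrier_vec p"
  shows "graph_mat p b *\<^sub>v x \<in> carrier_vec (Suc p)"
    and "vec p (\<lambda>i. (graph_mat p b *\<^sub>v x) $ i) = x"
    and "(graph_mat p b *\<^sub>v x) $ p = b \<bullet> x"
proof -
  show "graph_mat p b *\<^sub>v x \<in> carrier_vec (Suc p)"
    using mult_mat_vec_carrier[OF graph_mat_carrier assms(1)] .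
qed (use assms in \<open>auto simp: graph_mat_def scalar_prod_def vec_eq_iff if_distrib[of "\<lambda>a. a * _"] cong: if_cong\<close>)

lemma delete_last_col_mult_graph_mat:
  assumes "A \<in> carrier_mat k p"
  shows "delete_last_col (A * (graph_mat p b)\<^sup>T) = A"
  using assms by (intro eq_matI)
    (auto simp: delete_last_col_def graph_mat_def scalar_prod_def if_distrib[of "\<lambda>a. _ * a"] cong: if_cong)

text \<open>
  Deletion is surjective already on pairs of matrices. Write \<open>U = V \<inter> W\<^sup>\<bottom>\<close>. If \<open>U\<close> already has
  dimension at least \<open>k - r\<close>, zero columns are appended. Otherwise \<open>U\<close> is a proper subspace of \<open>V\<close>, and one gains a
  dimension by making some \<open>x \<in> V - U\<close> orthogonal to \<open>W\<close>: the second space is extended by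
  \<open>y \<mapsto> (y, - x \<bullet> y)\<close> and the first by \<open>y \<mapsto> (y, b \<bullet> y)\<close> with \<open>b \<bullet> x = 1\<close>. Choosing \<open>b\<close> inside \<open>W\<close> makes
  it vanish on \<open>U\<close>, so the vectors \<open>(y, 0)\<close> with \<open>y \<in> U\<close> stay in the intersection; the new vector
  \<open>(x, 1)\<close> is independent of them because of its last entry.
\<close>

lemma SH_lift:
  assumes A: "A \<in> carrier_mat k p" and B: "B \<in> carrier_mat k p" and "r < k"
    and SH: "(vec_space.row_space p A, vec_space.row_space p B) \<in> SH k p (r + 1)"
  shows "\<exists>A' B'. A' \<in> carrier_mat k (Suc p) \<and> B' \<in> carrier_mat k (Suc p)
    \<and> delete_last_col A' = A \<and> delete_last_col B' = B
    \<and> (vec_space.row_space (Suc p) A', vec_space.row_space (Suc p) B') \<in> SH k (Suc p) r"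
proof -
  let ?V = "vec_space.row_space p A" and ?W = "vec_space.row_space p B"
  let ?U = "?V \<inter> vec_module.orthogonal_complement p ?W"
  from SH have VWk: "?V \<in> subspaces k p" "?W \<in> subspaces k p"
    and d: "k - (r + 1) \<le> subspace_dim p ?U"
    by (auto simp: SH_def)
  have VW: "lin_subspace p ?V" "lin_subspace p ?W" and dimV: "subspace_dim p ?V = k"
    using VWk by (auto simp: subspaces_def)
  note carr = VW[THEN lin_subspaceD(1)]
  have U: "lin_subspace p ?U" using VW carr by (simp add: lin_subspace_inter_orthogonal_complement)
  have inj: "x = 0\<^sub>v p" if "graph_mat p a *\<^sub>v x = 0\<^sub>v (Suc p)" "x \<in> carrier_vec p" "a \<in> carrier_vec p" for a x
    using graph_mat_mult_vec(2)[OF that(2,3)] that(1) by (auto simp: vec_eq_iff)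
  have "\<exists>b c. b \<in> carrier_vec p \<and> c \<in> carrier_vec p \<and>
    k - r \<le> subspace_dim (Suc p) (vec_space.row_space (Suc p) (A * (graph_mat p b)\<^sup>T)
       \<inter> vec_module.orthogonal_complement (Suc p) (vec_space.row_space (Suc p) (B * (graph_mat p c)\<^sup>T)))"
    (is "\<exists>b c. _ \<and> _ \<and> _ \<le> subspace_dim (Suc p) (?U' b c)")
  proof -
    have row: "vec_space.row_space (Suc p) (M * (graph_mat p b)\<^sup>T)
       = (\<lambda>x. graph_mat p b *\<^sub>v x) ` vec_space.row_space p M"
      if "M \<in> carrier_mat k p" for b M
      using row_space_mult[OF that, of "(graph_mat p b)\<^sup>T" "Suc p"] by simp
    have U': "lin_subspace (Suc p) (?U' b c)" for b c
    proof -
      have "A * (graph_mat p b)\<^sup>T \<in> carrier_mat k (Suc p)" "B * (graph_mat p c)\<^sup>T \<in> carrier_mat k (Suc p)"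
        using A B by auto
      note sub = this[THEN row_space_rank_nullity(1)]
      show ?thesis
        using lin_subspace_inter_orthogonal_complement[OF sub(1) lin_subspaceD(1)[OF sub(2)]] .
    qed
    have dot: "(graph_mat p b *\<^sub>v x) \<bullet> (graph_mat p c *\<^sub>v y) = x \<bullet> y + (b \<bullet> x) * (c \<bullet> y)"
      if "x \<in> carrier_vec p" "y \<in> carrier_vec p" "b \<in> carrier_vec p" "c \<in> carrier_vec p" for b c x y
      using scalar_prod_Suc[of "graph_mat p b *\<^sub>v x" p "graph_mat p c *\<^sub>v y"]
        graph_mat_mult_vec[OF that(1,3)] graph_mat_mult_vec[OF that(2,4)] by simp
    have memU': "graph_mat p b *\<^sub>v x \<in> ?U' b c"
      if "x \<in> ?V" "b \<in> carrier_vec p" "c \<in> carrier_vec p"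
        "\<And>y. y \<in> ?W \<Longrightarrow> x \<bullet> y + (b \<bullet> x) * (c \<bullet> y) = 0" for b c x
      using that carr graph_mat_mult_vec(1)[of x p b]
      by (auto simp: row[OF A] row[OF B] orthogonal_complement_iff dot subset_iff)
    show ?thesis
    proof (cases "k - r \<le> subspace_dim p ?U")
      case True
      have "subspace_dim p ?U \<le> subspace_dim (Suc p) (?U' (0\<^sub>v p) (0\<^sub>v p))"
        by (rule subspace_dim_le_if_inj_into[OF U U', of "\<lambda>x. graph_mat p (0\<^sub>v p) *\<^sub>v x"])
          (use carr memU'[of _ "0\<^sub>v p" "0\<^sub>v p"] inj[of "0\<^sub>v p"] in \<open>auto simp: subset_iff orthogonal_complement_iff
            mult_add_distrib_mat_vec[of _ "Suc p" p] mult_mat_vec[of _ "Suc p" p]\<close>)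
      then show ?thesis using True by (meson order_trans zero_carrier_vec)
    next
      case False
      then have "subspace_dim p ?U < subspace_dim p ?V" using dimV \<open>r < k\<close> by linarith
      then obtain x where x: "x \<in> ?V" "x \<notin> ?U" by (metis inf_le1 order_less_irrefl subsetI subset_antisym)
      then obtain w where w: "w \<in> ?W" "x \<bullet> w \<noteq> 0" using carr by (auto simp: orthogonal_complement_iff)
      have xc: "x \<in> carrier_vec p" and wc: "w \<in> carrier_vec p" using x(1) w(1) carr by auto
      define b where "b = (1 / (x \<bullet> w)) \<cdot>\<^sub>v w"
      define c where "c = - x"
      have bW: "b \<in> ?W" unfolding b_def by (rule lin_subspaceD(4)[OF VW(2) w(1)])
      have bc: "b \<in> carrier_vec p" "c \<in> carrier_vec p" using xc wc by (auto simp: b_def c_def)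
      have bx: "b \<bullet> x = 1" using xc wc w(2) by (simp add: b_def comm_scalar_prod[OF wc xc])
      have bU: "b \<bullet> y = 0" if "y \<in> ?U" for y
        using that bW bc comm_scalar_prod[of b p y] by (auto simp: orthogonal_complement_iff)
      have x': "graph_mat p b *\<^sub>v x \<in> ?U' b c"
        by (rule memU'[OF x(1) bc]) (use xc carr in \<open>auto simp: bx c_def\<close>)
      let ?e = "unit_vec (Suc p) p :: complex vec"
      have e: "?e \<bullet> (graph_mat p b *\<^sub>v y) = b \<bullet> y" if "y \<in> carrier_vec p" for y
        using graph_mat_mult_vec[OF that bc(1)] by simp
      \<comment> \<open>The image of \<open>U\<close> lies in the kernel of the last coordinate, and \<open>(x, 1)\<close> does not.\<close>
      have "subspace_dim p ?U \<le> subspace_dim (Suc p) {z \<in> ?U' b c. ?e \<bullet> z = 0}"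
      proof (rule subspace_dim_le_if_inj_into[OF U, of _ _ "\<lambda>x. graph_mat p b *\<^sub>v x"])
        show "lin_subspace (Suc p) {z \<in> ?U' b c. ?e \<bullet> z = 0}"
          by (rule subspace_dim_functional(1)[OF U']) simp
      next
        fix y assume y: "y \<in> ?U"
        then have "graph_mat p b *\<^sub>v y \<in> ?U' b c"
          by (intro memU' bc) (auto simp: bU orthogonal_complement_iff)
        then show "graph_mat p b *\<^sub>v y \<in> {z \<in> ?U' b c. ?e \<bullet> z = 0}"
          using e[of y] bU[OF y] y by (auto simp: orthogonal_complement_iff)
      qed (use bc inj in \<open>auto simp: orthogonal_complement_iff
            mult_add_distrib_mat_vec[of _ "Suc p" p] mult_mat_vec[of _ "Suc p" p]\<close>)
      moreover have "subspace_dim (Suc p) {z \<in> ?U' b c. ?e \<bullet> z = 0} + 1 \<le> subspace_dim (Suc p) (?U' b c)"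
        by (rule subspace_dim_functional(3)[OF U' _ x']) (simp_all add: e[OF xc] bx)
      ultimately show ?thesis using bc d by (intro exI[of _ b] exI[of _ c]) linarith
    qed
  qed
  then obtain b c where bc: "b \<in> carrier_vec p" "c \<in> carrier_vec p"
    and d': "k - r \<le> subspace_dim (Suc p) (?U' b c)" by blast
  have "vec_space.row_space (Suc p) (A * (graph_mat p b)\<^sup>T) \<in> subspaces k (Suc p)"
    by (rule row_space_mult_in_subspaces[OF A _ VWk(1)]) (use inj bc in auto)
  moreover have "vec_space.row_space (Suc p) (B * (graph_mat p c)\<^sup>T) \<in> subspaces k (Suc p)"
    by (rule row_space_mult_in_subspaces[OF B _ VWk(2)]) (use inj bc in auto)
  ultimately have SH': "(vec_space.row_space (Suc p) (A * (graph_mat p b)\<^sup>T),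
       vec_space.row_space (Suc p) (B * (graph_mat p c)\<^sup>T)) \<in> SH k (Suc p) r"
    using d' by (simp add: SH_def)
  show ?thesis
    by (rule exI[of _ "A * (graph_mat p b)\<^sup>T"], rule exI[of _ "B * (graph_mat p c)\<^sup>T"])
      (use A B SH' in \<open>simp add: delete_last_col_mult_graph_mat\<close>)
qed

section \<open>Maximal minors under column operations\<close>

lemma submatrix_columns:
  assumes A: "A \<in> carrier_mat k n" and I: "I \<in> ksubsets k n"
  shows "submatrix A UNIV I = mat k k (\<lambda>(i, j). A $$ (i, pick I j))"
proof -
  have "{j. j < n \<and> j \<in> I} = I" using I by (auto simp: ksubsets_def)
  then show ?thesis using A I by (auto simp: submatrix_def ksubsets_def pick_UNIV)
qed

lemma pick_ksubset:
  assumes "I \<in> ksubsets k n"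
  shows "j < k \<Longrightarrow> pick I j \<in> I" and "i \<in> I \<Longrightarrow> \<exists>j<k. pick I j = i"
proof -
  have I: "finite I" "card I = k" using assms by (auto simp: ksubsets_def intro: finite_subset)
  show "j < k \<Longrightarrow> pick I j \<in> I" using I by (simp add: pick_in_set)
  assume i: "i \<in> I"
  have "card {a \<in> I. a < i} < card I"
    by (rule psubset_card_mono[OF I(1)]) (use i in auto)
  then show "\<exists>j<k. pick I j = i" using pick_card_in_set[OF i] I(2) by blast
qed

text \<open>
  Stating that a minor is nonzero through left kernel vectors makes the order of the columns, and
  hence the sign of the minor, irrelevant.
\<close>

lemma maximal_minor_nonzero_iff:
  fixes A :: "complex mat"
  assumes A: "A \<in> carrier_mat k n" and I: "I \<in> ksubsets k n"
  shows "maximal_minors k n A I \<noteq> 0 \<longleftrightarrow>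
    (\<forall>v\<in>carrier_vec k. (\<forall>i\<in>I. v \<bullet> col A i = 0) \<longrightarrow> v = 0\<^sub>v k)"
proof -
  let ?M = "submatrix A UNIV I"
  have M: "?M \<in> carrier_mat k k" by (simp add: submatrix_columns[OF A I])
  have In: "i < n" if "i \<in> I" for i using I that by (auto simp: ksubsets_def)
  have col: "col ?M j = col A (pick I j)" if "j < k" for j
    using that A In[OF pick_ksubset(1)[OF I that]]
    by (intro eq_vecI) (auto simp: submatrix_columns[OF A I])
  have *: "?M\<^sup>T *\<^sub>v v = 0\<^sub>v k \<longleftrightarrow> (\<forall>i\<in>I. v \<bullet> col A i = 0)" if v: "v \<in> carrier_vec k" for v
  proof -
    have "?M\<^sup>T *\<^sub>v v = 0\<^sub>v k \<longleftrightarrow> (\<forall>j<k. col A (pick I j) \<bullet> v = 0)"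
      using M v by (auto simp: vec_eq_iff col)
    also have "\<dots> \<longleftrightarrow> (\<forall>i\<in>I. col A i \<bullet> v = 0)"
      using pick_ksubset[OF I] by metis
    also have "\<dots> \<longleftrightarrow> (\<forall>i\<in>I. v \<bullet> col A i = 0)"
    proof -
      have "col A i \<in> carrier_vec k" for i using A by (simp add: carrier_vecI)
      then show ?thesis by (simp add: comm_scalar_prod[OF v])
    qed
    finally show ?thesis .
  qed
  have "maximal_minors k n A I = det (?M\<^sup>T)"
    using I M by (simp add: maximal_minors_def det_transpose)
  then show ?thesis
    using det_0_iff_vec_prod_zero[of "?M\<^sup>T" k] M * by auto
qed

lemma row_space_in_subspaces_if_minor:
  assumes A: "A \<in> carrier_mat k n" and nz: "maximal_minors k n A I \<noteq> 0"
  shows "vec_space.row_space n A \<in> subspaces k n"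
proof (rule row_space_in_subspacesI[OF A])
  fix y assume y: "y \<in> carrier_vec k" "A\<^sup>T *\<^sub>v y = 0\<^sub>v n"
  have I: "I \<in> ksubsets k n" using nz by (auto simp: maximal_minors_def split: if_splits)
  have "y \<bullet> col A i = 0" if "i < n" for i
  proof -
    have "(A\<^sup>T *\<^sub>v y) $ i = col A i \<bullet> y" using that A by simp
    then show ?thesis using y that A by (simp add: comm_scalar_prod[OF y(1)])
  qed
  moreover have "i < n" if "i \<in> I" for i using that I by (auto simp: ksubsets_def)
  ultimately show "y = 0\<^sub>v k"
    using nz y(1) by (simp add: maximal_minor_nonzero_iff[OF A I])
qed

text \<open>
  Up to signs the new minor is \<open>m\<^sub>J + t m\<^sub>I\<close> with \<open>J = I - {l} \<union> {j}\<close>, which vanishes for a single \<open>t\<close>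
  because \<open>m\<^sub>I \<noteq> 0\<close>. In terms of kernels: the vectors orthogonal to the columns in \<open>I - {l}\<close> form a line,
  and a generator determines the bad \<open>t\<close>.
\<close>

lemma maximal_minor_exchange:
  assumes A: "A \<in> carrier_mat k n" and nz: "maximal_minors k n A I \<noteq> 0"
    and l: "l \<in> I" and j: "j < n" "j \<notin> I"
  shows "\<exists>t0. \<forall>t. t \<noteq> t0 \<longrightarrow> maximal_minors k n (addcol t j l A) (insert j (I - {l})) \<noteq> 0"
proof -
  let ?J = "insert j (I - {l})"
  have I: "I \<in> ksubsets k n" using nz by (auto simp: maximal_minors_def split: if_splits)
  have In: "i < n" if "i \<in> I" for i using I that by (auto simp: ksubsets_def)
  have finI: "finite I" using I by (auto simp: ksubsets_def intro: finite_subset)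
  have "0 < card I" using finI l by (auto simp: card_gt_0_iff)
  then have J: "?J \<in> ksubsets k n"
    using I j l finI by (auto simp: ksubsets_def card_insert_if)
  have jl: "j \<noteq> l" using l j by auto
  have nzA: "v = 0\<^sub>v k" if "v \<in> carrier_vec k" "\<And>i. i \<in> I \<Longrightarrow> v \<bullet> col A i = 0" for v
    using nz that by (auto simp: maximal_minor_nonzero_iff[OF A I])
  have A': "addcol t j l A \<in> carrier_mat k n" for t using A by (intro carrier_matI) auto
  have colc: "col A i \<in> carrier_vec k" for i using A by (simp add: carrier_vecI)
  have colj: "col (addcol t j l A) j = t \<cdot>\<^sub>v col A l + col A j" for t
    using A j In[OF l] jl by (intro eq_vecI) auto
  have coli: "col (addcol t j l A) i = col A i" if "i \<in> I" for t i
    using A j In[OF that] that by (intro eq_vecI) auto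
  have dotj: "v \<bullet> col (addcol t j l A) j = t * (v \<bullet> col A l) + v \<bullet> col A j"
    if "v \<in> carrier_vec k" for v t
    using that colc by (simp add: colj scalar_prod_add_distrib[OF that])
  \<comment> \<open>The kernel vectors at two bad parameters are proportional, since their combination \<open>z\<close>
  is orthogonal to every column in \<open>I\<close>.\<close>
  have uniq: "s = t" if s: "maximal_minors k n (addcol s j l A) ?J = 0"
    and t: "maximal_minors k n (addcol t j l A) ?J = 0" for s t
  proof -
    have ex: "\<exists>v\<in>carrier_vec k. (\<forall>i\<in>I - {l}. v \<bullet> col A i = 0) \<and> v \<bullet> col A l \<noteq> 0 \<and>
        u * (v \<bullet> col A l) + v \<bullet> col A j = 0"
      if u: "maximal_minors k n (addcol u j l A) ?J = 0" for u
    proof -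
      obtain v where v: "v \<in> carrier_vec k" "v \<noteq> 0\<^sub>v k"
        "\<And>i. i \<in> ?J \<Longrightarrow> v \<bullet> col (addcol u j l A) i = 0"
        using u maximal_minor_nonzero_iff[OF A' J, of u] by blast
      have v0: "v \<bullet> col A i = 0" if "i \<in> I - {l}" for i using v(3)[of i] coli[of i u] that by simp
      have "v \<bullet> col A l \<noteq> 0" using nzA[OF v(1)] v0 v(2) by (metis Diff_iff empty_iff insert_iff)
      then show ?thesis using v(1) v0 v(3)[of j] dotj[OF v(1), of u] by auto
    qed
    obtain v where v: "v \<in> carrier_vec k" "\<And>i. i \<in> I - {l} \<Longrightarrow> v \<bullet> col A i = 0"
      "v \<bullet> col A l \<noteq> 0" "s * (v \<bullet> col A l) + v \<bullet> col A j = 0" using ex[OF s] by blast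
    obtain w where w: "w \<in> carrier_vec k" "\<And>i. i \<in> I - {l} \<Longrightarrow> w \<bullet> col A i = 0"
      "w \<bullet> col A l \<noteq> 0" "t * (w \<bullet> col A l) + w \<bullet> col A j = 0" using ex[OF t] by blast
    define z where "z = (w \<bullet> col A l) \<cdot>\<^sub>v v - (v \<bullet> col A l) \<cdot>\<^sub>v w"
    have zc: "z \<in> carrier_vec k" using v w by (simp add: z_def)
    have dotz: "z \<bullet> col A i = (w \<bullet> col A l) * (v \<bullet> col A i) - (v \<bullet> col A l) * (w \<bullet> col A i)" for i
      using v(1) w(1) colc by (simp add: z_def minus_scalar_prod_distrib[of _ k])
    have "z = 0\<^sub>v k"
    proof (rule nzA[OF zc])
      fix i assume "i \<in> I"
      then show "z \<bullet> col A i = 0" using v(2)[of i] w(2)[of i] by (cases "i = l") (simp_all add: dotz)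
    qed
    then have "(w \<bullet> col A l) * (v \<bullet> col A j) - (v \<bullet> col A l) * (w \<bullet> col A j) = 0"
      using dotz[of j] colc[of j] by simp
    moreover have "v \<bullet> col A j = - s * (v \<bullet> col A l)" "w \<bullet> col A j = - t * (w \<bullet> col A l)"
      using v(4) w(4) by (simp_all add: eq_neg_iff_add_eq_0 add.commute)
    ultimately have "(t - s) * ((v \<bullet> col A l) * (w \<bullet> col A l)) = 0" by (simp add: algebra_simps)
    then show "s = t" using v(3) w(3) by simp
  qed
  then show ?thesis by blast
qed

text \<open>
  By the Leibniz formula a minor is a polynomial in the entries.
\<close>

lemma tendsto_maximal_minors_addcol:
  fixes A :: "complex mat"
  assumes A: "A \<in> carrier_mat k n" and l: "l < n" and g: "(g \<longlongrightarrow> a) F"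
  shows "((\<lambda>t. maximal_minors k n (addcol (g t) j l A) I) \<longlongrightarrow> maximal_minors k n (addcol a j l A) I) F"
proof (cases "I \<in> ksubsets k n")
  case True
  have pick: "pick I m < n" if "m < k" for m
    using pick_ksubset(1)[OF True that] True by (auto simp: ksubsets_def)
  have det: "maximal_minors k n (addcol s j l A) I =
      (\<Sum>p | p permutes {0..<k}. signof p *
        (\<Prod>i = 0..<k. if j = pick I (p i) then s * A $$ (i, l) + A $$ (i, pick I (p i)) else A $$ (i, pick I (p i))))"
    for s
  proof -
    have c: "addcol s j l A \<in> carrier_mat k n" using A by (intro carrier_matI) auto
    have "p i < k" if "p permutes {0..<k}" "i < k" for p i
      using permutes_in_image[OF that(1), of i] that(2) by simp
    then show ?thesis
      using True A pick
      by (simp add: maximal_minors_def submatrix_columns[OF c True] det_def'[of _ k])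
  qed
  have "((\<lambda>t. if j = pick I (p i) then g t * A $$ (i, l) + A $$ (i, pick I (p i)) else A $$ (i, pick I (p i)))
      \<longlongrightarrow> (if j = pick I (p i) then a * A $$ (i, l) + A $$ (i, pick I (p i)) else A $$ (i, pick I (p i)))) F" for p i
    using g by (auto intro!: tendsto_intros)
  then show ?thesis unfolding det by (intro tendsto_intros)
qed (simp add: maximal_minors_def)

section \<open>Values of forms and Zariski closures\<close>

lemma forms_mono: "J \<subseteq> J' \<Longrightarrow> forms J \<subseteq> forms J'"
  unfolding forms_def by blast

lemma poly_value_cong_on:
  assumes "f \<in> forms J" "\<And>i. i \<in> J \<Longrightarrow> x i = y i"
  shows "poly_value f x = poly_value f y"
proof -
  have "Poly_Mapping.keys m \<subseteq> J" if "m \<in> Poly_Mapping.keys f" for m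
    using assms(1) that by (auto simp: forms_def)
  then show ?thesis
    unfolding poly_value_def using assms(2)
    by (intro sum.cong arg_cong2[of _ _ _ _ "(*)"] prod.cong) (auto simp: subset_iff)
qed

text \<open>
  Homogeneity: a form vanishes on a whole punctured line as soon as it vanishes at one
  representative.
\<close>

lemma poly_value_scale:
  assumes "f \<in> forms J"
  shows "\<exists>d. \<forall>c x. poly_value f (\<lambda>i. c * x i) = c ^ d * poly_value f x"
proof -
  obtain d where d: "\<And>m. m \<in> Poly_Mapping.keys f \<Longrightarrow> (\<Sum>i\<in>Poly_Mapping.keys m. Poly_Mapping.lookup m i) = d"
    using assms by (auto simp: forms_def)
  have "poly_value f (\<lambda>i. c * x i) = c ^ d * poly_value f x" for c x
    unfolding poly_value_def sum_distrib_left
    by (intro sum.cong) (simp_all add: power_mult_distrib prod.distrib power_sum[symmetric] d)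
  then show ?thesis by blast
qed

lemma tendsto_poly_value:
  assumes "\<And>i. ((\<lambda>t. X t i) \<longlongrightarrow> x i) F"
  shows "((\<lambda>t. poly_value f (X t)) \<longlongrightarrow> poly_value f x) F"
  unfolding poly_value_def by (intro tendsto_intros assms)

lemma self_in_point: "x \<in> point x"
  by (auto simp: point_def intro!: exI[of _ 1])

lemma vanishes_at_point:
  assumes "f \<in> forms J"
  shows "vanishes_at f (point x) \<longleftrightarrow> poly_value f x = 0"
proof
  assume "vanishes_at f (point x)"
  then show "poly_value f x = 0" using self_in_point[of x] by (simp add: vanishes_at_def)
next
  assume "poly_value f x = 0"
  then show "vanishes_at f (point x)"
    using poly_value_scale[OF assms] by (auto simp: vanishes_at_def point_def)
qed

lemma point_scale: "c \<noteq> 0 \<Longrightarrow> point (\<lambda>i. c * x i) = point x"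
proof -
  assume c: "c \<noteq> 0"
  have "\<exists>e. (\<lambda>i. d * x i) = (\<lambda>i. e * (c * x i)) \<and> e \<noteq> 0" if "d \<noteq> 0" for d
    using c that by (intro exI[of _ "d / c"]) auto
  moreover have "\<exists>e. (\<lambda>i. d * (c * x i)) = (\<lambda>i. e * x i) \<and> e \<noteq> 0" if "d \<noteq> 0" for d
    using c that by (intro exI[of _ "d * c"]) (auto simp: mult.assoc)
  ultimately show ?thesis unfolding point_def by blast
qed

lemma point_in_proj_space:
  "x \<in> coord_vecs J \<Longrightarrow> x \<noteq> (\<lambda>_. 0) \<Longrightarrow> point x \<in> proj_space J"
  by (auto simp: proj_space_def)

lemma zariski_closure_mono: "S \<subseteq> T \<Longrightarrow> zariski_closure J S \<subseteq> zariski_closure J T"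
  unfolding zariski_closure_def by blast

lemma zariski_closure_superset: "S \<subseteq> proj_space J \<Longrightarrow> S \<subseteq> zariski_closure J S"
  unfolding zariski_closure_def by blast

lemma zariski_closure_minimal:
  "S \<subseteq> zariski_closure J T \<Longrightarrow> zariski_closure J S \<subseteq> zariski_closure J T"
  unfolding zariski_closure_def by blast

section \<open>The Hadamard square and the inclusions\<close>

definition mandelstam_points :: "nat \<Rightarrow> nat \<Rightarrow> nat \<Rightarrow> (nat set \<Rightarrow> complex) set set" where
  "mandelstam_points k n r = {point (mandelstam_coords k n A B) | A B.
        A \<in> carrier_mat k n \<and> B \<in> carrier_mat k n \<and>
        (vec_space.row_space n A, vec_space.row_space n B) \<in> SH k n r \<and>
        mandelstam_coords k n A B \<noteq> (\<lambda>_. 0)}"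

lemma mandelstam_eq_closure: "mandelstam k n r = zariski_closure (ksubsets k n) (mandelstam_points k n r)"
  by (simp add: mandelstam_def mandelstam_points_def)

lemma mandelstam_coords_in_coord_vecs: "mandelstam_coords k n A B \<in> coord_vecs (ksubsets k n)"
  by (simp add: coord_vecs_def mandelstam_coords_def maximal_minors_def)

lemma mandelstam_points_subset_proj_space: "mandelstam_points k n r \<subseteq> proj_space (ksubsets k n)"
  using point_in_proj_space[OF mandelstam_coords_in_coord_vecs] by (auto simp: mandelstam_points_def)

lemma SH_mono: "k - r' \<le> k - r \<Longrightarrow> SH k n r \<subseteq> SH k n r'"
  by (auto simp: SH_def)

lemma mandelstam_mono: "k - r' \<le> k - r \<Longrightarrow> mandelstam k n r \<subseteq> mandelstam k n r'"
  unfolding mandelstam_eq_closure mandelstam_points_def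
  by (rule zariski_closure_mono) (use SH_mono[of k r' r n] in blast)

text \<open>
  For \<open>r = k\<close> the incidence condition reads \<open>dim (V \<inter> W\<^sup>\<bottom>) \<ge> 0\<close>, so \<open>V\<close> and \<open>W\<close> range independently over
  the Grassmannian; the two sets of points already agree before taking closures.
\<close>

lemma mandelstam_eq_hadamard_square:
  "mandelstam k n k = hadamard_square (ksubsets k n) (grassmannian k n)"
proof -
  let ?H = "{point (\<lambda>i. x i * y i) | x y p q.
        p \<in> grassmannian k n \<and> q \<in> grassmannian k n \<and> x \<in> p \<and> y \<in> q \<and> (\<lambda>i. x i * y i) \<noteq> (\<lambda>_. 0)}"
  have "mandelstam_points k n k \<subseteq> ?H"
  proof
    fix s assume "s \<in> mandelstam_points k n k"
    then obtain A B where s: "s = point (mandelstam_coords k n A B)"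
      and AB: "A \<in> carrier_mat k n" "B \<in> carrier_mat k n"
        "vec_space.row_space n A \<in> subspaces k n" "vec_space.row_space n B \<in> subspaces k n"
        "mandelstam_coords k n A B \<noteq> (\<lambda>_. 0)"
      by (auto simp: mandelstam_points_def SH_def)
    let ?a = "maximal_minors k n A" and ?b = "maximal_minors k n B"
    have "point ?a \<in> grassmannian k n" "point ?b \<in> grassmannian k n"
      using AB by (auto simp: grassmannian_def)
    then show "s \<in> ?H"
      using self_in_point[of ?a] self_in_point[of ?b] AB(5)
      unfolding s mandelstam_coords_def mem_Collect_eq
      by (intro exI[of _ ?a] exI[of _ ?b] exI[of _ "point ?a"] exI[of _ "point ?b"]) simp
  qed
  moreover have "?H \<subseteq> mandelstam_points k n k"
  proof
    fix s assume "s \<in> ?H"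
    then obtain x y A B where s: "s = point (\<lambda>i. x i * y i)"
      and AB: "A \<in> carrier_mat k n" "B \<in> carrier_mat k n"
        "vec_space.row_space n A \<in> subspaces k n" "vec_space.row_space n B \<in> subspaces k n"
      and xy: "x \<in> point (maximal_minors k n A)" "y \<in> point (maximal_minors k n B)"
        "(\<lambda>i. x i * y i) \<noteq> (\<lambda>_. 0)"
      by (auto simp: grassmannian_def)
    obtain c d where cd: "c \<noteq> 0" "d \<noteq> 0"
      "x = (\<lambda>i. c * maximal_minors k n A i)" "y = (\<lambda>i. d * maximal_minors k n B i)"
      using xy by (auto simp: point_def)
    have eq: "(\<lambda>i. x i * y i) = (\<lambda>i. (c * d) * mandelstam_coords k n A B i)"
      by (simp add: cd mandelstam_coords_def mult_ac)
    then have "mandelstam_coords k n A B \<noteq> (\<lambda>_. 0)" using xy(3) by auto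
    moreover have "s = point (mandelstam_coords k n A B)"
      unfolding s eq by (rule point_scale) (use cd in simp)
    ultimately show "s \<in> mandelstam_points k n k"
      using AB by (auto simp: mandelstam_points_def SH_def)
  qed
  ultimately show ?thesis unfolding mandelstam_eq_closure hadamard_square_def by simp
qed

section \<open>Deletion in coordinates\<close>

lemma ksubsets_Suc_iff: "p \<notin> I \<Longrightarrow> I \<in> ksubsets k (Suc p) \<longleftrightarrow> I \<in> ksubsets k p"
  by (auto simp: ksubsets_def less_Suc_eq)

lemma ksubsets_less: "I \<in> ksubsets k p \<Longrightarrow> p \<notin> I"
  by (auto simp: ksubsets_def)

lemma maximal_minors_delete_last_col:
  assumes A: "A \<in> carrier_mat k (Suc p)" and "p \<notin> I"
  shows "maximal_minors k (Suc p) A I = maximal_minors k p (delete_last_col A) I"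
proof (cases "I \<in> ksubsets k p")
  case True
  have A': "delete_last_col A \<in> carrier_mat k p" using A by (auto simp: delete_last_col_def)
  have T': "I \<in> ksubsets k (Suc p)" using True assms(2) by (simp add: ksubsets_Suc_iff)
  have "pick I j < p" if "j < k" for j
    using pick_ksubset(1)[OF True that] True by (auto simp: ksubsets_def)
  then have "submatrix A UNIV I = submatrix (delete_last_col A) UNIV I"
    using A unfolding submatrix_columns[OF A T'] submatrix_columns[OF A' True]
    by (intro eq_matI) (auto simp: delete_last_col_def)
  then show ?thesis using True T' by (simp add: maximal_minors_def)
qed (use assms in \<open>simp add: maximal_minors_def ksubsets_Suc_iff\<close>)

lemma forget_last_mandelstam_coords:
  assumes "A \<in> carrier_mat k (Suc p)" "B \<in> carrier_mat k (Suc p)"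
  shows "forget_last (Suc p) (mandelstam_coords k (Suc p) A B)
    = mandelstam_coords k p (delete_last_col A) (delete_last_col B)"
proof
  fix I
  show "forget_last (Suc p) (mandelstam_coords k (Suc p) A B) I
    = mandelstam_coords k p (delete_last_col A) (delete_last_col B) I"
  proof (cases "p \<in> I")
    case True
    then have "I \<notin> ksubsets k p" using ksubsets_less by blast
    then show ?thesis using True by (simp add: forget_last_def mandelstam_coords_def maximal_minors_def)
  next
    case False
    then show ?thesis
      using assms by (simp add: forget_last_def mandelstam_coords_def maximal_minors_delete_last_col)
  qed
qed

lemma deletion_point: "deletion n (point x) = point (forget_last n x)"
proof -
  have "forget_last n (\<lambda>i. c * x i) = (\<lambda>i. c * forget_last n x i)" for c
    by (auto simp: forget_last_def)
  then have "point (forget_last n x) = {forget_last n (\<lambda>i. c * x i) | c. c \<noteq> 0}"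
    by (simp add: point_def)
  then show ?thesis unfolding deletion_def point_def by blast
qed

section \<open>Density of the domain of the deletion map\<close>

text \<open>
  A pair all of whose common nonzero minors involve the last column \<open>p\<close> is a limit of pairs that
  survive deletion. Let \<open>I\<close> be a common nonzero minor, choose a column \<open>j\<close> outside \<open>I\<close> and put
  \<open>J = I - {p} \<union> {j}\<close>. A shear of \<open>A\<close> makes its minor \<open>J\<close> nonzero for small \<open>t \<noteq> 0\<close> while the minor \<open>I\<close>
  of \<open>B\<close> remains nonzero; a second shear, with the roles of \<open>A\<close> and \<open>B\<close> exchanged, then does the same
  for the minor \<open>J\<close> of \<open>B\<close>. Since values of polynomials are continuous, vanishing on the perturbed
  pairs is inherited by the limit.
\<close>

lemma poly_value_zero_by_perturbation:
  assumes "k < Suc p"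
    and vanish: "\<And>A B. A \<in> carrier_mat k (Suc p) \<Longrightarrow> B \<in> carrier_mat k (Suc p) \<Longrightarrow>
        (vec_space.row_space (Suc p) A, vec_space.row_space (Suc p) B) \<in> SH k (Suc p) r \<Longrightarrow>
        forget_last (Suc p) (mandelstam_coords k (Suc p) A B) \<noteq> (\<lambda>_. 0) \<Longrightarrow>
        poly_value f (mandelstam_coords k (Suc p) A B) = 0"
    and A: "A \<in> carrier_mat k (Suc p)" and B: "B \<in> carrier_mat k (Suc p)"
    and SH: "(vec_space.row_space (Suc p) A, vec_space.row_space (Suc p) B) \<in> SH k (Suc p) r"
    and nz: "mandelstam_coords k (Suc p) A B \<noteq> (\<lambda>_. 0)"
  shows "poly_value f (mandelstam_coords k (Suc p) A B) = 0"
proof (cases "forget_last (Suc p) (mandelstam_coords k (Suc p) A B) = (\<lambda>_. 0)")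
  case False
  show ?thesis by (rule vanish[OF A B SH False])
next
  case True
  let ?n = "Suc p"
  let ?m = "maximal_minors k ?n"
  let ?SH = "\<lambda>A B. (vec_space.row_space ?n A, vec_space.row_space ?n B) \<in> SH k ?n r"
  obtain I where I: "?m A I \<noteq> 0" "?m B I \<noteq> 0"
    using nz unfolding mandelstam_coords_def by fastforce
  have Ik: "I \<in> ksubsets k ?n" using I(1) unfolding maximal_minors_def by meson
  have pI: "p \<in> I"
  proof (rule ccontr)
    assume "p \<notin> I"
    then have "forget_last ?n (mandelstam_coords k ?n A B) I \<noteq> 0"
      using I by (simp add: forget_last_def mandelstam_coords_def)
    then show False using True by simp
  qed
  have "card I = k" using Ik by (simp add: ksubsets_def)
  then have "I \<noteq> {0..<?n}" using \<open>k < Suc p\<close> by (metis card_atLeastLessThan diff_zero less_irrefl)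
  moreover have "I \<subseteq> {0..<?n}" using Ik by (simp add: ksubsets_def)
  ultimately obtain j where "j \<in> {0..<?n} - I" by blast
  then have j: "j < ?n" "j \<notin> I" by auto
  have jp: "j \<noteq> p" using j pI by auto
  let ?J = "insert j (I - {p})"
  have pJ: "p \<notin> ?J" using jp by simp
  have good: "poly_value f (mandelstam_coords k ?n A B) = 0"
    if "A \<in> carrier_mat k ?n" "B \<in> carrier_mat k ?n" "?SH A B" "?m A ?J \<noteq> 0" "?m B ?J \<noteq> 0" for A B
  proof (rule vanish[OF that(1-3)])
    have "forget_last ?n (mandelstam_coords k ?n A B) ?J \<noteq> 0"
      using that(4,5) pJ by (simp add: forget_last_def mandelstam_coords_def)
    then show "forget_last ?n (mandelstam_coords k ?n A B) \<noteq> (\<lambda>_. 0)" by auto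
  qed
  have addcol_carrier: "addcol t a b M \<in> carrier_mat k ?n" if "M \<in> carrier_mat k ?n" for t a b and M :: "complex mat"
    using that by (intro carrier_matI) auto
  have addcol_0: "addcol 0 a b M = M" for a b and M :: "complex mat"
    by (intro eq_matI) auto
  have keep: "\<forall>\<^sub>F t in at 0. ?m (addcol (c * t) a b M) K \<noteq> 0"
    if "M \<in> carrier_mat k ?n" "b < ?n" "?m M K \<noteq> 0" for a b c K and M :: "complex mat"
  proof -
    have "((\<lambda>t. c * t) \<longlongrightarrow> 0) (at 0)" by (auto intro!: tendsto_eq_intros)
    from tendsto_maximal_minors_addcol[OF that(1,2) this, of a K] show ?thesis
      using that(3) by (intro tendsto_imp_eventually_ne) (auto simp: addcol_0)
  qed
  have exchange: "\<forall>\<^sub>F t in at 0. ?m (addcol t j p M) ?J \<noteq> 0"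
    if M: "M \<in> carrier_mat k ?n" "?m M I \<noteq> 0" for M
  proof -
    obtain t0 where t0: "\<And>t. t \<noteq> t0 \<Longrightarrow> ?m (addcol t j p M) ?J \<noteq> 0"
      using maximal_minor_exchange[OF M pI j] by blast
    show ?thesis
      by (rule eventually_mono[OF eventually_neq_at_within[of t0]]) (rule t0)
  qed
  \<comment> \<open>The factors \<open>c\<close>, \<open>c'\<close> are the two signs in \<open>SH_shear\<close>; they differ between the two uses.\<close>
  have limit: "poly_value f (mandelstam_coords k ?n A B) = 0"
    if A: "A \<in> carrier_mat k ?n" and B: "B \<in> carrier_mat k ?n" and "b < ?n" "b' < ?n"
      and ev: "\<forall>\<^sub>F t in at 0. poly_value f (mandelstam_coords k ?n (addcol (c * t) a b A) (addcol (c' * t) a' b' B)) = 0"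
    for A B a b a' b' c c'
  proof -
    have c: "((\<lambda>t. c * t) \<longlongrightarrow> 0) (at 0)" for c :: complex by (auto intro!: tendsto_eq_intros)
    have "((\<lambda>t. poly_value f (mandelstam_coords k ?n (addcol (c * t) a b A) (addcol (c' * t) a' b' B)))
       \<longlongrightarrow> poly_value f (mandelstam_coords k ?n (addcol 0 a b A) (addcol 0 a' b' B))) (at 0)"
      unfolding mandelstam_coords_def
      by (rule tendsto_poly_value, rule tendsto_mult)
        (rule tendsto_maximal_minors_addcol[OF A \<open>b < ?n\<close> c], rule tendsto_maximal_minors_addcol[OF B \<open>b' < ?n\<close> c])
    moreover have "((\<lambda>t. poly_value f (mandelstam_coords k ?n (addcol (c * t) a b A) (addcol (c' * t) a' b' B)))
       \<longlongrightarrow> 0) (at 0)"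
      using ev by (rule tendsto_eventually)
    ultimately have "poly_value f (mandelstam_coords k ?n (addcol 0 a b A) (addcol 0 a' b' B)) = 0"
      by (rule tendsto_unique[OF at_neq_bot])
    then show ?thesis by (simp add: addcol_0)
  qed
  \<comment> \<open>The second of the two limits: the minor \<open>J\<close> of \<open>A\<close> is already nonzero.\<close>
  have half: "poly_value f (mandelstam_coords k ?n A B) = 0"
    if A: "A \<in> carrier_mat k ?n" and B: "B \<in> carrier_mat k ?n" and SH: "?SH A B"
      and nzA: "?m A ?J \<noteq> 0" and nzB: "?m B I \<noteq> 0" for A B
  proof (rule limit[OF A B, of j p "- 1" p 1 j])
    show "\<forall>\<^sub>F t in at 0. poly_value f (mandelstam_coords k ?n (addcol (- 1 * t) p j A) (addcol (1 * t) j p B)) = 0"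
      using keep[OF A j(1) nzA, of "- 1" p] exchange[OF B nzB]
    proof eventually_elim
      case (elim t)
      show ?case
      proof (rule good)
        show "?SH (addcol (- 1 * t) p j A) (addcol (1 * t) j p B)"
          using SH_shear[OF A B _ j(1) _ SH, of p "- t"] jp by simp
      qed (use elim in \<open>simp_all add: addcol_carrier A B\<close>)
    qed
  qed (use j(1) in simp_all)
  show ?thesis
  proof (rule limit[OF A B, of p j 1 j "- 1" p])
    show "\<forall>\<^sub>F t in at 0. poly_value f (mandelstam_coords k ?n (addcol (1 * t) j p A) (addcol (- 1 * t) p j B)) = 0"
      using keep[OF B j(1) I(2), of "- 1" p] exchange[OF A I(1)]
    proof eventually_elim
      case (elim t)
      show ?case
      proof (rule half)
        show "?SH (addcol (1 * t) j p A) (addcol (- 1 * t) p j B)"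
          using SH_shear[OF A B j(1) _ jp SH, of t] by simp
      qed (use elim in \<open>simp_all add: addcol_carrier A B\<close>)
    qed
  qed (use j(1) in simp_all)
qed

definition surviving_points :: "nat \<Rightarrow> nat \<Rightarrow> nat \<Rightarrow> (nat set \<Rightarrow> complex) set set" where
  "surviving_points k n r = {point (mandelstam_coords k n A B) | A B.
        A \<in> carrier_mat k n \<and> B \<in> carrier_mat k n \<and>
        (vec_space.row_space n A, vec_space.row_space n B) \<in> SH k n r \<and>
        forget_last n (mandelstam_coords k n A B) \<noteq> (\<lambda>_. 0)}"

lemma surviving_points_subset: "surviving_points k n r \<subseteq> mandelstam_points k n r"
proof -
  have "x \<noteq> (\<lambda>_. 0)" if "forget_last n x \<noteq> (\<lambda>_. 0)" for x
  proof
    assume "x = (\<lambda>_. 0)"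
    then have "forget_last n x = (\<lambda>_. 0)" by (auto simp: forget_last_def)
    then show False using that by simp
  qed
  then show ?thesis unfolding surviving_points_def mandelstam_points_def by blast
qed

lemma mandelstam_eq_closure_surviving_points:
  assumes "k < Suc p"
  shows "mandelstam k (Suc p) r = zariski_closure (ksubsets k (Suc p)) (surviving_points k (Suc p) r)"
    (is "_ = zariski_closure ?K ?S0")
proof
  have "mandelstam_points k (Suc p) r \<subseteq> zariski_closure ?K ?S0"
  proof
    fix s assume s: "s \<in> mandelstam_points k (Suc p) r"
    then obtain A B where AB: "s = point (mandelstam_coords k (Suc p) A B)"
        "A \<in> carrier_mat k (Suc p)" "B \<in> carrier_mat k (Suc p)"
        "(vec_space.row_space (Suc p) A, vec_space.row_space (Suc p) B) \<in> SH k (Suc p) r"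
        "mandelstam_coords k (Suc p) A B \<noteq> (\<lambda>_. 0)"
      by (auto simp: mandelstam_points_def)
    have "vanishes_at f s" if f: "f \<in> forms ?K" and van: "\<forall>q\<in>?S0. vanishes_at f q" for f
      unfolding AB(1) vanishes_at_point[OF f]
    proof (rule poly_value_zero_by_perturbation[OF assms _ AB(2-5)])
      fix A B assume "A \<in> carrier_mat k (Suc p)" "B \<in> carrier_mat k (Suc p)"
        "(vec_space.row_space (Suc p) A, vec_space.row_space (Suc p) B) \<in> SH k (Suc p) r"
        "forget_last (Suc p) (mandelstam_coords k (Suc p) A B) \<noteq> (\<lambda>_. 0)"
      then have "point (mandelstam_coords k (Suc p) A B) \<in> ?S0"
        unfolding surviving_points_def by blast
      then show "poly_value f (mandelstam_coords k (Suc p) A B) = 0"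
        using van vanishes_at_point[OF f] by blast
    qed
    then show "s \<in> zariski_closure ?K ?S0"
      using subsetD[OF mandelstam_points_subset_proj_space s] by (simp add: zariski_closure_def)
  qed
  then show "mandelstam k (Suc p) r \<subseteq> zariski_closure ?K ?S0"
    unfolding mandelstam_eq_closure by (rule zariski_closure_minimal)
  show "zariski_closure ?K ?S0 \<subseteq> mandelstam k (Suc p) r"
    unfolding mandelstam_eq_closure by (rule zariski_closure_mono[OF surviving_points_subset])
qed

lemma point_in_deletion_domain:
  assumes "point x \<in> X" "forget_last n x \<noteq> (\<lambda>_. 0)"
  shows "point x \<in> deletion_domain n X"
proof -
  obtain i where i: "forget_last n x i \<noteq> 0" using assms(2) by fastforce
  have "forget_last n y \<noteq> (\<lambda>_. 0)" if "y \<in> point x" for y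
  proof -
    obtain c where "c \<noteq> 0" "y = (\<lambda>i. c * x i)" using \<open>y \<in> point x\<close> by (auto simp: point_def)
    then have "forget_last n y i \<noteq> 0" using i by (simp add: forget_last_def split: if_splits)
    then show ?thesis by metis
  qed
  then show ?thesis using assms(1) by (simp add: deletion_domain_def)
qed

section \<open>The deletion maps\<close>

text \<open>
  The domain contains the surviving points, and their closure is the whole source. For the target:
  a form in the remaining coordinates is also a form in all coordinates, and it takes the same value
  before and after deletion. If it vanishes on the points of the target, it therefore vanishes on the
  surviving points, hence on their closure.
\<close>

lemma deletion_rational_map_mandelstam:
  assumes "k < Suc p"
  shows "deletion_rational_map k (Suc p) (mandelstam k (Suc p) r) (mandelstam k p (r + 1))"
  unfolding deletion_rational_map_def
proof
  let ?X = "mandelstam k (Suc p) r" and ?K = "ksubsets k (Suc p)"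
  let ?S0 = "surviving_points k (Suc p) r"
  have X: "?X = zariski_closure ?K ?S0" by (rule mandelstam_eq_closure_surviving_points[OF assms])
  have "?S0 \<subseteq> proj_space ?K"
    by (rule order_trans[OF surviving_points_subset mandelstam_points_subset_proj_space])
  then have "?S0 \<subseteq> ?X" unfolding X by (rule zariski_closure_superset)
  then have "?S0 \<subseteq> deletion_domain (Suc p) ?X"
    using point_in_deletion_domain unfolding surviving_points_def by blast
  then have "?X \<subseteq> zariski_closure ?K (deletion_domain (Suc p) ?X)"
    unfolding X by (intro zariski_closure_mono) blast
  moreover have "deletion_domain (Suc p) ?X \<subseteq> zariski_closure ?K ?S0"
    unfolding X by (auto simp: deletion_domain_def)
  then have "zariski_closure ?K (deletion_domain (Suc p) ?X) \<subseteq> ?X"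
    using zariski_closure_minimal unfolding X by blast
  ultimately show "zariski_closure ?K (deletion_domain (Suc p) ?X) = ?X" by blast
  show "deletion (Suc p) ` deletion_domain (Suc p) ?X \<subseteq> mandelstam k p (r + 1)"
  proof
    fix s assume "s \<in> deletion (Suc p) ` deletion_domain (Suc p) ?X"
    then obtain q where q: "q \<in> ?X" "\<And>x. x \<in> q \<Longrightarrow> forget_last (Suc p) x \<noteq> (\<lambda>_. 0)" "s = deletion (Suc p) q"
      by (auto simp: deletion_domain_def)
    have "q \<in> proj_space ?K" using q(1) by (simp add: X zariski_closure_def)
    then obtain x where x: "q = point x" "x \<in> coord_vecs ?K" by (auto simp: proj_space_def)
    have nz: "forget_last (Suc p) x \<noteq> (\<lambda>_. 0)" using q(2) self_in_point x(1) by blast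
    have s: "s = point (forget_last (Suc p) x)" by (simp add: q(3) x(1) deletion_point)
    have "forget_last (Suc p) x \<in> coord_vecs (ksubsets k p)"
      using x(2) by (auto simp: coord_vecs_def forget_last_def ksubsets_Suc_iff)
    then have "s \<in> proj_space (ksubsets k p)" unfolding s using nz by (rule point_in_proj_space)
    moreover have "vanishes_at g s"
      if g: "g \<in> forms (ksubsets k p)" and van: "\<forall>q\<in>mandelstam_points k p (r + 1). vanishes_at g q" for g
    proof -
      have "ksubsets k p \<subseteq> ?K" by (auto simp: ksubsets_def)
      then have g': "g \<in> forms ?K" using g forms_mono by blast
      have forget: "poly_value g (forget_last (Suc p) y) = poly_value g y" for y
        by (rule poly_value_cong_on[OF g]) (auto simp: forget_last_def dest: ksubsets_less)
      have "vanishes_at g t" if t: "t \<in> ?S0" for t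
      proof -
        obtain A B where AB: "t = point (mandelstam_coords k (Suc p) A B)"
          "A \<in> carrier_mat k (Suc p)" "B \<in> carrier_mat k (Suc p)"
          "(vec_space.row_space (Suc p) A, vec_space.row_space (Suc p) B) \<in> SH k (Suc p) r"
          and nz': "forget_last (Suc p) (mandelstam_coords k (Suc p) A B) \<noteq> (\<lambda>_. 0)"
          using t unfolding surviving_points_def by blast
        let ?A = "delete_last_col A" and ?B = "delete_last_col B"
        have AB': "?A \<in> carrier_mat k p" "?B \<in> carrier_mat k p"
          using AB(2,3) by (auto simp: delete_last_col_def)
        note fl = forget_last_mandelstam_coords[OF AB(2,3)]
        obtain I where "maximal_minors k p ?A I \<noteq> 0" "maximal_minors k p ?B I \<noteq> 0"
          using nz' unfolding fl by (auto simp: mandelstam_coords_def fun_eq_iff)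
        then have "vec_space.row_space p ?A \<in> subspaces k p" "vec_space.row_space p ?B \<in> subspaces k p"
          using AB' row_space_in_subspaces_if_minor by blast+
        from SH_delete_last_col[OF AB(2-4) this]
        have "point (mandelstam_coords k p ?A ?B) \<in> mandelstam_points k p (r + 1)"
          using AB' nz' unfolding fl mandelstam_points_def by blast
        then have "poly_value g (mandelstam_coords k p ?A ?B) = 0"
          using van vanishes_at_point[OF g] by blast
        then show ?thesis unfolding AB(1) vanishes_at_point[OF g'] using forget fl by metis
      qed
      then have "vanishes_at g q" using q(1) g' by (simp add: X zariski_closure_def)
      then show ?thesis unfolding s x(1) vanishes_at_point[OF g] vanishes_at_point[OF g'] forget .
    qed
    ultimately show "s \<in> mandelstam k p (r + 1)"
      by (auto simp: mandelstam_eq_closure zariski_closure_def)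
  qed
qed

text \<open>
  By \<open>SH_lift\<close> the image of the deletion map contains every parametrised point of the target.
\<close>

lemma deletion_dominant_mandelstam:
  assumes "k < Suc p" "r < k"
  shows "deletion_dominant k (Suc p) (mandelstam k (Suc p) r) (mandelstam k p (r + 1))"
proof -
  let ?D = "deletion (Suc p) ` deletion_domain (Suc p) (mandelstam k (Suc p) r)"
  have "mandelstam_points k p (r + 1) \<subseteq> ?D"
  proof
    fix s assume "s \<in> mandelstam_points k p (r + 1)"
    then obtain A B where AB: "s = point (mandelstam_coords k p A B)"
        "A \<in> carrier_mat k p" "B \<in> carrier_mat k p"
        "(vec_space.row_space p A, vec_space.row_space p B) \<in> SH k p (r + 1)"
        "mandelstam_coords k p A B \<noteq> (\<lambda>_. 0)"
      by (auto simp: mandelstam_points_def)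
    obtain A' B' where AB': "A' \<in> carrier_mat k (Suc p)" "B' \<in> carrier_mat k (Suc p)"
        "delete_last_col A' = A" "delete_last_col B' = B"
        "(vec_space.row_space (Suc p) A', vec_space.row_space (Suc p) B') \<in> SH k (Suc p) r"
      using SH_lift[OF AB(2,3) assms(2) AB(4)] by blast
    let ?x = "mandelstam_coords k (Suc p) A' B'"
    have fl: "forget_last (Suc p) ?x = mandelstam_coords k p A B"
      using forget_last_mandelstam_coords[OF AB'(1,2)] AB'(3,4) by simp
    have "?x \<noteq> (\<lambda>_. 0)"
    proof
      assume "?x = (\<lambda>_. 0)"
      then have "forget_last (Suc p) ?x = (\<lambda>_. 0)" by (auto simp: forget_last_def)
      then show False using fl AB(5) by simp
    qed
    then have "point ?x \<in> mandelstam_points k (Suc p) r"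
      using AB' by (auto simp: mandelstam_points_def)
    then have "point ?x \<in> mandelstam k (Suc p) r"
      using zariski_closure_superset[OF mandelstam_points_subset_proj_space]
      unfolding mandelstam_eq_closure by blast
    then have "point ?x \<in> deletion_domain (Suc p) (mandelstam k (Suc p) r)"
      using AB(5) by (intro point_in_deletion_domain) (simp_all add: fl)
    then show "s \<in> ?D" using deletion_point[of "Suc p" ?x] unfolding fl AB(1) by (metis imageI)
  qed
  then have "mandelstam k p (r + 1) \<subseteq> zariski_closure (ksubsets k p) ?D"
    unfolding mandelstam_eq_closure[of k p] by (rule zariski_closure_mono)
  moreover have "zariski_closure (ksubsets k p) ?D \<subseteq> mandelstam k p (r + 1)"
    using deletion_rational_map_mandelstam[OF assms(1), of r] zariski_closure_minimal
    unfolding deletion_rational_map_def mandelstam_eq_closure[of k p] by blast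
  ultimately show ?thesis by (simp add: deletion_dominant_def)
qed

lemma deletion_induced_by_columns_Suc: "deletion_induced_by_columns k (Suc p) r"
  unfolding deletion_induced_by_columns_def
proof (intro allI impI conjI; elim conjE)
  fix A B :: "complex mat"
  assume AB: "A \<in> carrier_mat k (Suc p)" "B \<in> carrier_mat k (Suc p)"
    "(vec_space.row_space (Suc p) A, vec_space.row_space (Suc p) B) \<in> SH k (Suc p) r"
  show "forget_last (Suc p) (mandelstam_coords k (Suc p) A B) =
      mandelstam_coords k (Suc p - 1) (delete_last_col A) (delete_last_col B)"
    using forget_last_mandelstam_coords[OF AB(1,2)] by simp
  assume "vec_space.row_space (Suc p - 1) (delete_last_col A) \<in> subspaces k (Suc p - 1)"
    "vec_space.row_space (Suc p - 1) (delete_last_col B) \<in> subspaces k (Suc p - 1)"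
  then show "(vec_space.row_space (Suc p - 1) (delete_last_col A),
      vec_space.row_space (Suc p - 1) (delete_last_col B)) \<in> SH k (Suc p - 1) (r + 1)"
    using SH_delete_last_col[OF AB] by simp
qed

theorem proposition4p13:
  fixes k n :: nat
  assumes "k \<ge> 1" and "n \<ge> 2 * k"
  shows "mandelstam k n k = hadamard_square (ksubsets k n) (grassmannian k n) \<and>
    (\<forall>r. mandelstam k n r \<subseteq> mandelstam k n k) \<and>
    (\<forall>r<k. mandelstam k n r \<subseteq> mandelstam k n (r + 1)) \<and>
    (\<forall>r<k.
       deletion_rational_map k (n - r) (mandelstam k (n - r) r)
         (mandelstam k (n - (r + 1)) (r + 1)) \<and>
       deletion_dominant k (n - r) (mandelstam k (n - r) r)
         (mandelstam k (n - (r + 1)) (r + 1)) \<and>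
       deletion_induced_by_columns k (n - r) r)"
proof (intro conjI allI impI)
  show "mandelstam k n k = hadamard_square (ksubsets k n) (grassmannian k n)"
    by (rule mandelstam_eq_hadamard_square)
  show "mandelstam k n r \<subseteq> mandelstam k n k" for r by (rule mandelstam_mono) simp
  show "mandelstam k n r \<subseteq> mandelstam k n (r + 1)" for r by (rule mandelstam_mono) simp
  fix r assume "r < k"
  define p where "p = n - (r + 1)"
  \<comment> \<open>Since \<open>r < k\<close> and \<open>n \<ge> 2 k\<close>, more than \<open>k\<close> columns are present before each deletion.\<close>
  have p: "n - r = Suc p" "n - (r + 1) = p" "k < Suc p"
    using assms \<open>r < k\<close> by (auto simp: p_def)
  show "deletion_rational_map k (n - r) (mandelstam k (n - r) r) (mandelstam k (n - (r + 1)) (r + 1))"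
    unfolding p by (rule deletion_rational_map_mandelstam[OF p(3)])
  show "deletion_dominant k (n - r) (mandelstam k (n - r) r) (mandelstam k (n - (r + 1)) (r + 1))"
    unfolding p by (rule deletion_dominant_mandelstam[OF p(3) \<open>r < k\<close>])
  show "deletion_induced_by_columns k (n - r) r"
    unfolding p by (rule deletion_induced_by_columns_Suc)
qed

end
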